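(* Let $\varphi_1,\varphi_2\in L^2(\mathbb{R}^d)\setminus\{0\}$ be arbitrary and $a\in L^\infty(\mathbb{R}^{2d})$. Then $$\|\mathcal{F}-A_a^{\varphi_1,\varphi_2}\|_{op}\ge 1 ,$$ where $\mathcal{F}$ is the Fourier transform on $L^2(\mathbb{R}^d)$ and $\|\cdot\|_{op}$ is the operator norm on $B(L^2(\mathbb{R}^d))$. Consequently, the set of all localization operators with symbols in $L^\infty(\mathbb{R}^{2d})$ is not dense in $B(L^2(\mathbb{R}^d))$ with respect to the operator norm.
   Context: For $z=(x,\xi)\in\mathbb{R}^{2d}$ the time-frequency shift is $\pi(z)f(t)=e^{2\pi i\xi\cdot t}f(t-x)$. The short-time Fourier transform is $V_gf(z)=\langle f,\pi(z)g\rangle$ (inner product of $L^2(\mathbb{R}^d)$, linear in the first argument). For windows $\varphi_1,\varphi_2\in L^2(\mathbb{R}^d)$ and a symbol $a\in L^\infty(\mathbb{R}^{2d})$, the localization operator $A_a^{\varphi_1,\varphi_2}\in B(L^2(\mathbb{R}^d))$ is defined weakly by $\langle A_a^{\varphi_1,\varphi_2}f,g\rangle=\int_{\mathbb{R}^{2d}}a(z)\,V_{\varphi_1}f(z)\,\overline{V_{\varphi_2}g(z)}\,dz$. The Fourier transform is the unitary operator $\mathcal{F}f(\omega)=\hat f(\omega)=\int_{\mathbb{R}^d}f(t)e^{-2\pi i\omega\cdot t}\,dt$. *)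

theory Defs
  imports "HOL-Analysis.Analysis"
begin

section \<open>The Hilbert space of square-integrable functions\<close>

definition square_integrable :: "('a::euclidean_space \<Rightarrow> complex) \<Rightarrow> bool" where
  "square_integrable f \<longleftrightarrow>
     f \<in> borel_measurable lborel \<and> integrable lborel (\<lambda>t. (cmod (f t))\<^sup>2)"

lemma borel_measurable_cnj [measurable]: "cnj \<in> borel_measurable borel"
  by (intro borel_measurable_continuous_onI continuous_intros)

lemma square_integrable_zero: "square_integrable (\<lambda>_. 0)"
  by (simp add: square_integrable_def)

lemma square_integrable_cmult:
  assumes "square_integrable f" shows "square_integrable (\<lambda>t. c * f t)"
  using assms by (auto simp: square_integrable_def norm_mult power_mult_distrib)

lemma square_integrable_add:
  assumes "square_integrable f" "square_integrable g"
  shows "square_integrable (\<lambda>t. f t + g t)"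
  unfolding square_integrable_def
proof
  show m: "(\<lambda>t. f t + g t) \<in> borel_measurable lborel"
    using assms by (auto simp: square_integrable_def)
  have "(cmod (f t + g t))\<^sup>2 \<le> 2 * (cmod (f t))\<^sup>2 + 2 * (cmod (g t))\<^sup>2" for t
  proof -
    have "(cmod (f t + g t))\<^sup>2 \<le> (cmod (f t) + cmod (g t))\<^sup>2"
      by (intro power_mono norm_triangle_ineq) auto
    also have "\<dots> \<le> 2 * (cmod (f t))\<^sup>2 + 2 * (cmod (g t))\<^sup>2"
      using sum_squares_bound[of "cmod (f t)" "cmod (g t)"] by (simp add: power2_sum)
    finally show ?thesis .
  qed
  moreover have "integrable lborel (\<lambda>t. 2 * (cmod (f t))\<^sup>2 + 2 * (cmod (g t))\<^sup>2)"
    using assms by (auto simp: square_integrable_def)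
  ultimately show "integrable lborel (\<lambda>t. (cmod (f t + g t))\<^sup>2)"
    using m by (elim Bochner_Integration.integrable_bound) auto
qed

lemma integrable_mult_cnj:
  assumes "square_integrable f" "square_integrable g"
  shows "integrable lborel (\<lambda>t. f t * cnj (g t))"
proof -
  have [measurable]: "f \<in> borel_measurable lborel" "g \<in> borel_measurable lborel"
    using assms by (auto simp: square_integrable_def)
  have "cmod (f t) * cmod (g t) \<le> (cmod (f t))\<^sup>2 + (cmod (g t))\<^sup>2" for t
    using sum_squares_bound[of "cmod (f t)" "cmod (g t)"]
      mult_nonneg_nonneg[OF norm_ge_zero[of "f t"] norm_ge_zero[of "g t"]] by linarith
  moreover have "integrable lborel (\<lambda>t. (cmod (f t))\<^sup>2 + (cmod (g t))\<^sup>2)"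
    using assms by (auto simp: square_integrable_def)
  moreover have "(\<lambda>t. f t * cnj (g t)) \<in> borel_measurable lborel"
    by measurable
  ultimately show ?thesis
    by (elim Bochner_Integration.integrable_bound) (auto simp: norm_mult)
qed

lemma square_integrable_translate:
  fixes f :: "'a::euclidean_space \<Rightarrow> complex"
  assumes "square_integrable f"
  shows "square_integrable (\<lambda>t. f (t - x))"
proof -
  have [measurable]: "f \<in> borel_measurable lborel" and
    "integrable lborel (\<lambda>t. (cmod (f t))\<^sup>2)"
    using assms by (auto simp: square_integrable_def)
  then have "integrable (distr lborel borel ((+) (- x))) (\<lambda>t. (cmod (f t))\<^sup>2)"
    by (simp only: lborel_distr_plus)
  then have "integrable lborel (\<lambda>t. (cmod (f (- x + t)))\<^sup>2)"
    by (subst (asm) integrable_distr_eq) auto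
  then show ?thesis by (simp add: square_integrable_def)
qed

definition L2_eq :: "('a::euclidean_space \<Rightarrow> complex) \<Rightarrow> ('a \<Rightarrow> complex) \<Rightarrow> bool" where
  "L2_eq f g \<longleftrightarrow> square_integrable f \<and> square_integrable g \<and> (AE t in lborel. f t = g t)"

lemma L2_eqI: "square_integrable f \<Longrightarrow> square_integrable g \<Longrightarrow> AE t in lborel. f t = g t \<Longrightarrow> L2_eq f g"
  by (simp add: L2_eq_def)

quotient_type (overloaded) 'a L2 = "'a::euclidean_space \<Rightarrow> complex" / partial: L2_eq
proof (rule part_equivpI)
  show "\<exists>f. L2_eq f (f :: 'a \<Rightarrow> complex)"
    using square_integrable_zero by (auto simp: L2_eq_def)
  show "symp (L2_eq :: ('a \<Rightarrow> complex) \<Rightarrow> _)"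
    by (auto simp: symp_def L2_eq_def elim: eventually_mono)
  show "transp (L2_eq :: ('a \<Rightarrow> complex) \<Rightarrow> _)"
    by (auto simp: transp_def L2_eq_def elim: eventually_elim2)
qed

lift_definition cinner :: "'a::euclidean_space L2 \<Rightarrow> 'a L2 \<Rightarrow> complex" is
  "\<lambda>f g. \<integral>t. f t * cnj (g t) \<partial>lborel"
proof -
  fix f f' g g' :: "'a \<Rightarrow> complex"
  assume A: "L2_eq f f'" "L2_eq g g'"
  then have [measurable]: "f \<in> borel_measurable lborel" "f' \<in> borel_measurable lborel"
    "g \<in> borel_measurable lborel" "g' \<in> borel_measurable lborel"
    by (auto simp: L2_eq_def square_integrable_def)
  have "AE t in lborel. f t = f' t" "AE t in lborel. g t = g' t"
    using A by (auto simp: L2_eq_def)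
  then have "AE t in lborel. f t * cnj (g t) = f' t * cnj (g' t)"
    by eventually_elim simp
  then show "(\<integral>t. f t * cnj (g t) \<partial>lborel) = (\<integral>t. f' t * cnj (g' t) \<partial>lborel)"
    by (intro integral_cong_AE) auto
qed

lift_definition cscale :: "complex \<Rightarrow> 'a::euclidean_space L2 \<Rightarrow> 'a L2" is "\<lambda>c f t. c * f t"
  by (auto simp: L2_eq_def intro: square_integrable_cmult)

instantiation L2 :: (euclidean_space) real_inner
begin

lift_definition zero_L2 :: "'a L2" is "\<lambda>_. 0"
  by (simp add: L2_eq_def square_integrable_zero)

lift_definition plus_L2 :: "'a L2 \<Rightarrow> 'a L2 \<Rightarrow> 'a L2" is "\<lambda>f g t. f t + g t"
  by (auto simp: L2_eq_def intro: square_integrable_add elim: eventually_elim2)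

definition uminus_L2 :: "'a L2 \<Rightarrow> 'a L2" where "- f = cscale (- 1) f"

definition minus_L2 :: "'a L2 \<Rightarrow> 'a L2 \<Rightarrow> 'a L2" where "f - g = f + - (g :: 'a L2)"

definition scaleR_L2 :: "real \<Rightarrow> 'a L2 \<Rightarrow> 'a L2" where "scaleR r f = cscale (of_real r) f"

definition inner_L2 :: "'a L2 \<Rightarrow> 'a L2 \<Rightarrow> real" where "inner f g = Re (cinner f g)"

definition norm_L2 :: "'a L2 \<Rightarrow> real" where "norm f = sqrt (inner f (f :: 'a L2))"

definition sgn_L2 :: "'a L2 \<Rightarrow> 'a L2" where "sgn f = inverse (norm f) *\<^sub>R (f :: 'a L2)"

definition dist_L2 :: "'a L2 \<Rightarrow> 'a L2 \<Rightarrow> real" where "dist f g = norm (f - g :: 'a L2)"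

definition uniformity_L2 :: "('a L2 \<times> 'a L2) filter" where
  "uniformity = (INF e\<in>{0<..}. principal {(f :: 'a L2, g). dist f g < e})"

definition open_L2 :: "'a L2 set \<Rightarrow> bool" where
  "open U = (\<forall>f\<in>U. \<forall>\<^sub>F (f', g) in uniformity. f' = f \<longrightarrow> g \<in> (U :: 'a L2 set))"

instance
proof
  fix f g h :: "'a L2" and r s :: real
  show "f + g + h = f + (g + h)"
    by transfer
      (auto intro!: L2_eqI square_integrable_add simp: L2_eq_def add.assoc)
  show "f + g = g + f"
    by transfer (auto intro!: L2_eqI square_integrable_add simp: L2_eq_def add.commute)
  show "0 + f = f"
    by transfer (auto simp: L2_eq_def)
  show "- f + f = 0"
    unfolding uminus_L2_def
    by transfer
      (auto simp: L2_eq_def square_integrable_zero)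
  show "f - g = f + - g" by (simp add: minus_L2_def)
  show "r *\<^sub>R (f + g) = r *\<^sub>R f + r *\<^sub>R g"
    unfolding scaleR_L2_def
    by transfer (auto intro!: L2_eqI square_integrable_add square_integrable_cmult
        simp: L2_eq_def distrib_left)
  show "(r + s) *\<^sub>R f = r *\<^sub>R f + s *\<^sub>R f"
    unfolding scaleR_L2_def
    by transfer (auto intro!: L2_eqI square_integrable_add square_integrable_cmult
        simp: L2_eq_def distrib_right)
  show "r *\<^sub>R s *\<^sub>R f = (r * s) *\<^sub>R f"
    unfolding scaleR_L2_def
    by transfer (auto intro!: L2_eqI square_integrable_cmult simp: L2_eq_def mult.assoc)
  show "1 *\<^sub>R f = f"
    unfolding scaleR_L2_def by transfer (auto simp: L2_eq_def)
  show "dist f g = norm (f - g)" by (simp add: dist_L2_def)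
  show "sgn f = inverse (norm f) *\<^sub>R f" by (simp add: sgn_L2_def)
  show "uniformity = (INF e\<in>{0<..}. principal {(f :: 'a L2, g). dist f g < e})"
    by (simp add: uniformity_L2_def)
  show "open U = (\<forall>f\<in>U. \<forall>\<^sub>F (f', g) in uniformity. f' = f \<longrightarrow> g \<in> U)" for U :: "'a L2 set"
    by (simp add: open_L2_def)
  have cnj: "cinner f g = cnj (cinner g f)"
    by transfer (subst Bochner_Integration.integral_cnj [symmetric], simp add: mult.commute
        del: Bochner_Integration.integral_cnj)
  show "f \<bullet> g = g \<bullet> f" by (simp add: inner_L2_def cnj)
  have "cinner (f + g) h = cinner f h + cinner g h"
    by transfer
      (simp add: distrib_right L2_eq_def integrable_mult_cnj)
  then show "(f + g) \<bullet> h = f \<bullet> h + g \<bullet> h" by (simp add: inner_L2_def)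
  have "cinner (cscale (of_real r) f) g = of_real r * cinner f g"
    by transfer (simp add: mult.assoc)
  then show "r *\<^sub>R f \<bullet> g = r * (f \<bullet> g)" by (simp add: inner_L2_def scaleR_L2_def)
  have sq: "f t * cnj (f t) = of_real ((cmod (f t))\<^sup>2)" for f :: "'a \<Rightarrow> complex" and t
    by (simp only: complex_norm_square)
  have re: "Re (\<integral>t. f t * cnj (f t) \<partial>lborel) = (\<integral>t. (cmod (f t))\<^sup>2 \<partial>lborel)"
    for f :: "'a \<Rightarrow> complex"
    by (simp only: sq integral_complex_of_real Re_complex_of_real)
  show "0 \<le> f \<bullet> f"
    unfolding inner_L2_def by transfer (simp only: re, simp)
  show "f \<bullet> f = 0 \<longleftrightarrow> f = 0"
    unfolding inner_L2_def
    by transfer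
      (auto simp: re L2_eq_def square_integrable_def integral_nonneg_eq_0_iff_AE)
  show "norm f = sqrt (f \<bullet> f)" by (simp add: norm_L2_def)
qed

end


section \<open>Time-frequency shifts, localization operators and the Fourier transform\<close>

lift_definition tf_shift :: "'a::euclidean_space \<times> 'a \<Rightarrow> 'a L2 \<Rightarrow> 'a L2" is
  "\<lambda>(x, \<xi>) f t. cis (2 * pi * (\<xi> \<bullet> t)) * f (t - x)"
proof (clarify)
  fix x \<xi> :: 'a and f g :: "'a \<Rightarrow> complex"
  assume A: "L2_eq f g"
  have si: "square_integrable (\<lambda>t. cis (2 * pi * (\<xi> \<bullet> t)) * h (t - x))"
    if "square_integrable h" for h :: "'a \<Rightarrow> complex"
  proof -
    have "cis = (\<lambda>y. exp (\<i> * complex_of_real y))" by (simp add: cis_conv_exp fun_eq_iff)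
    then have [measurable]: "(\<lambda>t. cis (2 * pi * (\<xi> \<bullet> t))) \<in> borel_measurable lborel"
      by (auto intro!: borel_measurable_continuous_onI continuous_intros)
    show ?thesis
      using square_integrable_translate[OF that, of x]
      by (auto simp: square_integrable_def norm_mult)
  qed
  have "AE t in distr lborel borel ((+) (- x)). f t = g t"
    using A by (simp only: L2_eq_def lborel_distr_plus)
  then have "AE t in lborel. f (- x + t) = g (- x + t)"
    by (rule AE_distrD[rotated]) measurable
  then show "L2_eq (\<lambda>t. cis (2 * pi * (\<xi> \<bullet> t)) * f (t - x)) (\<lambda>t. cis (2 * pi * (\<xi> \<bullet> t)) * g (t - x))"
    using A by (intro L2_eqI si) (auto simp: L2_eq_def)
qed

definition stft :: "'a::euclidean_space L2 \<Rightarrow> 'a L2 \<Rightarrow> 'a \<times> 'a \<Rightarrow> complex" where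
  "stft g f z = cinner f (tf_shift z g)"

text \<open>Every class in \<open>L\<^sup>\<infinity>\<close> of Lebesgue measure has a Borel representative, so Borel functions
  suffice here and in \<open>square_integrable\<close>.\<close>

definition Linfty :: "('b::euclidean_space \<Rightarrow> complex) set" where
  "Linfty = {a. a \<in> borel_measurable lborel \<and> (\<exists>C. AE z in lborel. cmod (a z) \<le> C)}"

text \<open>\<^typ>\<open>'a L2 \<Rightarrow>\<^sub>L 'a L2\<close> consists of the bounded real-linear operators, with the operator norm;
  \<open>B(L\<^sup>2)\<close> is its subset of complex-linear ones.\<close>

definition bounded_clinear_ops :: "('a::euclidean_space L2 \<Rightarrow>\<^sub>L 'a L2) set" where
  "bounded_clinear_ops = {T. \<forall>c f. blinfun_apply T (cscale c f) = cscale c (blinfun_apply T f)}"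

text \<open>By the orthogonality relations for the STFT the integral is a bounded sesquilinear form in
  \<open>f\<close>, \<open>g\<close>, so for \<open>a \<in> Linfty\<close> there is exactly one operator as described.\<close>

definition localization_op ::
    "'a::euclidean_space L2 \<Rightarrow> 'a L2 \<Rightarrow> ('a \<times> 'a \<Rightarrow> complex) \<Rightarrow> 'a L2 \<Rightarrow>\<^sub>L 'a L2" where
  "localization_op \<phi>1 \<phi>2 a = (THE A. A \<in> bounded_clinear_ops \<and> (\<forall>f g.
     cinner (blinfun_apply A f) g = (\<integral>z. a z * stft \<phi>1 f z * cnj (stft \<phi>2 g z) \<partial>lborel)))"

definition fourier_integral :: "('a::euclidean_space \<Rightarrow> complex) \<Rightarrow> 'a \<Rightarrow> complex" where
  "fourier_integral f \<omega> = (\<integral>t. f t * cis (- (2 * pi * (\<omega> \<bullet> t))) \<partial>lborel)"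

text \<open>The integral formula makes sense on \<open>L\<^sup>1 \<inter> L\<^sup>2\<close>; the Fourier transform on \<open>L\<^sup>2\<close> is its
  unique bounded linear extension.\<close>

definition fourier :: "'a::euclidean_space L2 \<Rightarrow>\<^sub>L 'a L2" where
  "fourier = (THE F. F \<in> bounded_clinear_ops \<and> (\<forall>f. integrable lborel f \<and> square_integrable f \<longrightarrow>
     square_integrable (fourier_integral f) \<and>
     blinfun_apply F (abs_L2 f) = abs_L2 (fourier_integral f)))"

end

theory Submission
  imports Defs "HOL-Probability.Characteristic_Functions"
begin

text \<open>
  The reason behind the theorem is that the Fourier transform moves mass through the
  time-frequency plane while a localization operator \<open>A\<close> with bounded symbol \<open>a\<close> leaves it where
  it is. Let \<open>\<gamma>\<close> be the Gaussian \<open>exp (- \<pi> \<bar>t\<bar>\<^sup>2)\<close>, which is its own Fourier transform. The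
  translate \<open>f\<close> of \<open>\<gamma>\<close> by \<open>y\<close> is concentrated at the point \<open>(y, 0)\<close>, and its Fourier transform
  \<open>g\<close> is the modulation of \<open>\<gamma>\<close> by \<open>- y\<close>, concentrated at \<open>(0, - y)\<close>. By covariance of the
  short-time Fourier transform \<open>V\<close>, the functions \<open>\<bar>V f\<bar>\<close> and \<open>\<bar>V g\<bar>\<close> are translates of two
  fixed functions in \<open>L\<^sup>2\<close> of the time-frequency plane, and the distance between the two
  translations grows with \<open>\<bar>y\<bar>\<close>. Since \<open>a\<close> is bounded, \<open>\<langle>A f, g\<rangle>\<close> is therefore as small as we
  please when \<open>\<bar>y\<bar>\<close> is large (\<open>localization_op_off_diagonal_bound\<close>), whereas \<open>\<langle>\<F> f, g\<rangle> = \<parallel>\<gamma>\<parallel>\<^sup>2\<close>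
  and \<open>\<parallel>f\<parallel> = \<parallel>g\<parallel> = \<parallel>\<gamma>\<parallel>\<close>. So \<open>\<parallel>\<F> - A\<parallel> \<ge> 1\<close>, and \<open>\<F>\<close> itself witnesses that localization operators
  are not dense.

  To reason about \<open>\<F>\<close> and \<open>A\<close> one must know that operators with their defining properties
  exist. Both constructions rest on a single inequality, \<open>\<parallel>\<F> f\<parallel> \<le> \<parallel>f\<parallel>\<close> for the Fourier integral
  (\<open>fourier_integral_Bessel\<close>), which follows from positivity of the heat kernel. The inequality
  makes the Fourier integral extend continuously from truncated functions to all of \<open>L\<^sup>2\<close>, which
  is complete. Applied in the frequency variable alone it shows that the short-time Fourier
  transform of a function in \<open>L\<^sup>2\<close> lies in \<open>L\<^sup>2\<close> of the plane, so that the form defining \<open>A\<close> is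
  bounded and, by Riesz representation, comes from an operator.
\<close>

section \<open>The complex Hilbert space of square-integrable functions\<close>

lemma square_integrable_rep_L2: "square_integrable (rep_L2 f)"
  using Quotient3_rep_reflp[OF Quotient3_L2, of f] by (simp add: L2_eq_def)

lemma abs_rep_L2: "abs_L2 (rep_L2 f) = f"
  by (rule Quotient3_abs_rep[OF Quotient3_L2])

lemma abs_L2_exhaust:
  obtains g where "square_integrable g" "f = abs_L2 g"
  using that[OF square_integrable_rep_L2 abs_rep_L2[symmetric]] .

lemma square_integrable_measurable:
  "square_integrable f \<Longrightarrow> f \<in> borel_measurable borel"
  by (simp add: square_integrable_def)

lemma L2_eq_refl: "square_integrable f \<Longrightarrow> L2_eq f f"
  by (simp add: L2_eq_def)

lemma square_integrable_minus:
  "square_integrable f \<Longrightarrow> square_integrable g \<Longrightarrow> square_integrable (\<lambda>t. f t - g t)"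
  using square_integrable_add[of f "\<lambda>t. (- 1) * g t"] square_integrable_cmult[of g "- 1"] by simp

lemma square_integrable_iff_nn_integral:
  "square_integrable f \<longleftrightarrow>
     f \<in> borel_measurable borel \<and> (\<integral>\<^sup>+t. ennreal ((cmod (f t))\<^sup>2) \<partial>lborel) < \<infinity>"
  by (auto simp: square_integrable_def integrable_iff_bounded)

lemma square_integrable_dominated:
  assumes "f \<in> borel_measurable borel" "square_integrable g" "\<And>t. cmod (f t) \<le> cmod (g t)"
  shows "square_integrable f"
  unfolding square_integrable_def
proof
  show "f \<in> borel_measurable lborel"
    using assms(1) by simp
  have meas: "(\<lambda>t. (cmod (f t))\<^sup>2) \<in> borel_measurable lborel"
    using assms(1) by measurable
  have bound: "AE t in lborel. norm ((cmod (f t))\<^sup>2) \<le> norm ((cmod (g t))\<^sup>2)"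
  proof (rule AE_I2)
    show "norm ((cmod (f t))\<^sup>2) \<le> norm ((cmod (g t))\<^sup>2)" for t
      unfolding real_norm_def abs_power2 by (intro power_mono assms(3) norm_ge_zero)
  qed
  have "integrable lborel (\<lambda>t. (cmod (g t))\<^sup>2)"
    using assms(2) unfolding square_integrable_def by blast
  then show "integrable lborel (\<lambda>t. (cmod (f t))\<^sup>2)"
    using meas bound by (rule Bochner_Integration.integrable_bound)
qed

lemma abs_L2_add:
  "square_integrable f \<Longrightarrow> square_integrable g \<Longrightarrow> abs_L2 f + abs_L2 g = abs_L2 (\<lambda>t. f t + g t)"
  by (simp add: plus_L2.abs_eq L2_eq_refl)

lemma cscale_abs_L2:
  "square_integrable f \<Longrightarrow> cscale c (abs_L2 f) = abs_L2 (\<lambda>t. c * f t)"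
  by (simp add: cscale.abs_eq L2_eq_refl)

lemma abs_L2_minus:
  "square_integrable f \<Longrightarrow> square_integrable g \<Longrightarrow> abs_L2 f - abs_L2 g = abs_L2 (\<lambda>t. f t - g t)"
  using abs_L2_add[of f "\<lambda>t. (- 1) * g t"] square_integrable_cmult[of g "- 1"]
  by (simp add: minus_L2_def uminus_L2_def cscale_abs_L2)

lemma cinner_abs_L2:
  "square_integrable f \<Longrightarrow> square_integrable g \<Longrightarrow>
     cinner (abs_L2 f) (abs_L2 g) = (\<integral>t. f t * cnj (g t) \<partial>lborel)"
  by (simp add: cinner.abs_eq L2_eq_refl)

lemma cinner_self: "cinner f f = complex_of_real ((norm f)\<^sup>2)"
proof -
  obtain g where g: "square_integrable g" "f = abs_L2 g" by (rule abs_L2_exhaust)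
  have "cinner f f = complex_of_real (\<integral>t. (cmod (g t))\<^sup>2 \<partial>lborel)"
    using g by (simp only: cinner_abs_L2 flip: complex_norm_square integral_complex_of_real)
  then show ?thesis
    by (simp add: norm_L2_def inner_L2_def)
qed

lemma norm_abs_L2_square:
  assumes "square_integrable f"
  shows "(norm (abs_L2 f))\<^sup>2 = (\<integral>t. (cmod (f t))\<^sup>2 \<partial>lborel)"
proof -
  have "cinner (abs_L2 f) (abs_L2 f) = complex_of_real (\<integral>t. (cmod (f t))\<^sup>2 \<partial>lborel)"
    using assms by (simp only: cinner_abs_L2 flip: complex_norm_square integral_complex_of_real)
  then show ?thesis
    unfolding cinner_self of_real_eq_iff .
qed

lemma nn_integral_square_eq_norm:
  assumes "square_integrable f"
  shows "(\<integral>\<^sup>+t. ennreal ((cmod (f t))\<^sup>2) \<partial>lborel) = ennreal ((norm (abs_L2 f))\<^sup>2)"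
  using assms by (subst nn_integral_eq_integral) (auto simp: square_integrable_def norm_abs_L2_square)

text \<open>
  Norm bounds below are obtained as inequalities between nonnegative integrals, where no
  integrability has to be known in advance; finiteness of the bound then yields membership in
  \<open>L\<^sup>2\<close> as well.
\<close>

lemma norm_abs_L2_le:
  assumes "f \<in> borel_measurable borel"
    and "(\<integral>\<^sup>+t. ennreal ((cmod (f t))\<^sup>2) \<partial>lborel) \<le> ennreal (c\<^sup>2)" "0 \<le> c"
  shows "square_integrable f" "norm (abs_L2 f) \<le> c"
proof -
  show f: "square_integrable f"
    using assms by (auto simp: square_integrable_iff_nn_integral intro: le_less_trans)
  have "ennreal ((norm (abs_L2 f))\<^sup>2) \<le> ennreal (c\<^sup>2)"
    using assms(2) by (simp add: nn_integral_square_eq_norm[OF f])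
  then show "norm (abs_L2 f) \<le> c"
    using assms(3) by (auto intro: power2_le_imp_le)
qed

lemma cinner_commute: "cinner f g = cnj (cinner g f)"
  by transfer (subst Bochner_Integration.integral_cnj [symmetric], simp add: mult.commute
        del: Bochner_Integration.integral_cnj)

lemma cinner_add_left: "cinner (f + g) h = cinner f h + cinner g h"
  by transfer (simp add: distrib_right L2_eq_def integrable_mult_cnj)

lemma cinner_cscale_left: "cinner (cscale c f) g = c * cinner f g"
  by transfer (simp add: mult.assoc)

lemma cinner_add_right: "cinner h (f + g) = cinner h f + cinner h g"
  by (simp add: cinner_commute[of h] cinner_add_left)

lemma cinner_cscale_right: "cinner g (cscale c f) = cnj c * cinner g f"
  by (simp add: cinner_commute[of g] cinner_cscale_left)

lemma cinner_minus_left: "cinner (f - g) h = cinner f h - cinner g h"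
  using cinner_add_left[of "f - g" g h] by simp

lemma cinner_minus_right: "cinner h (f - g) = cinner h f - cinner h g"
  using cinner_add_right[of h "f - g" g] by simp

lemma scaleR_eq_cscale: "r *\<^sub>R f = cscale (complex_of_real r) f"
  by (rule scaleR_L2_def)

lemma norm_cscale: "norm (cscale c f) = cmod c * norm f"
proof -
  have "complex_of_real ((norm (cscale c f))\<^sup>2) = complex_of_real ((cmod c * norm f)\<^sup>2)"
    unfolding cinner_self[symmetric] power_mult_distrib of_real_mult
    using complex_norm_square[of c] by (simp add: cinner_cscale_left cinner_cscale_right)
  then show ?thesis
    unfolding of_real_eq_iff by (rule power2_eq_imp_eq) auto
qed

text \<open>
  The real inner product only sees the real part of \<open>cinner\<close>; multiplying \<open>f\<close> by a suitable phase
  makes \<open>cinner f g\<close> real and nonnegative, and then the real Cauchy-Schwarz inequality applies.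
\<close>

lemma cmod_cinner_le: "cmod (cinner f g) \<le> norm f * norm g"
proof (cases "cinner f g = 0")
  case False
  define u where "u = cnj (sgn (cinner f g))"
  have u: "cmod u = 1" "u * cinner f g = complex_of_real (cmod (cinner f g))"
    using False by (simp_all add: u_def sgn_eq complex_norm_square[symmetric]
        power2_eq_square mult.commute norm_divide)
  have "cmod (cinner f g) = cscale u f \<bullet> g"
    by (simp add: inner_L2_def cinner_cscale_left u)
  also have "\<dots> \<le> norm (cscale u f) * norm g"
    by (rule norm_cauchy_schwarz)
  finally show ?thesis
    by (simp add: norm_cscale u)
qed simp

lemma L2_eqI_cinner:
  assumes "\<And>g. cinner f g = cinner f' g"
  shows "f = f'"
proof -
  have "cinner (f - f') (f - f') = 0"
    using assms[of "f - f'"] by (simp add: cinner_minus_left)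
  then show ?thesis by (simp add: cinner_self)
qed

section \<open>Completeness\<close>

text \<open>
  The arithmetic-geometric mean inequality bounds \<open>\<parallel>d\<parallel>\<close> by \<open>2\<^sup>n \<parallel>d\<parallel>\<^sup>2 + 2\<^sup>-\<^sup>n\<close>.  The weight turns
  pointwise convergence of a sequence in \<open>L\<^sup>2\<close> into a statement about integrals of squares.
\<close>

lemma summable_norm_of_weighted_squares:
  fixes d :: "nat \<Rightarrow> 'b::real_normed_vector"
  assumes "summable (\<lambda>n. 2 ^ n * (norm (d n))\<^sup>2)"
  shows "summable (\<lambda>n. norm (d n))"
proof (rule summable_comparison_test')
  show "summable (\<lambda>n. 2 ^ n * (norm (d n))\<^sup>2 + (1 / 2) ^ n)"
    using assms by (intro summable_add) (auto intro: summable_geometric)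
  show "norm (norm (d n)) \<le> 2 ^ n * (norm (d n))\<^sup>2 + (1 / 2) ^ n" for n
  proof -
    have "norm (d n) \<le> 2 * norm (d n)" by simp
    also have "\<dots> = (1/2)^n * (2 * (2 ^ n * norm (d n)) * 1)"
      by (simp add: power_divide)
    also have "\<dots> \<le> (1/2)^n * ((2 ^ n * norm (d n))\<^sup>2 + 1\<^sup>2)"
      by (intro mult_left_mono sum_squares_bound) auto
    also have "\<dots> = 2 ^ n * (norm (d n))\<^sup>2 + (1 / 2) ^ n"
      by (simp add: power_mult_distrib power_divide field_simps power2_eq_square)
    finally show ?thesis by simp
  qed
qed

lemma convergent_of_summable_steps:
  fixes y :: "nat \<Rightarrow> 'b::banach"
  assumes "summable (\<lambda>n. norm (y (Suc n) - y n))"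
  shows "convergent y"
proof -
  have "summable (\<lambda>n. y (Suc n) - y n)"
    using assms by (rule summable_norm_cancel)
  then have "(\<lambda>n. \<Sum>i<n. y (Suc i) - y i) \<longlonglongrightarrow> suminf (\<lambda>n. y (Suc n) - y n)"
    by (rule summable_LIMSEQ)
  then have "(\<lambda>n. (y n - y 0) + y 0) \<longlonglongrightarrow> suminf (\<lambda>n. y (Suc n) - y n) + y 0"
    unfolding sum_lessThan_telescope by (intro tendsto_intros)
  then show ?thesis by (auto simp: convergent_def)
qed

text \<open>
  The sum of \<open>2\<^sup>n \<bar>y\<^sub>n\<^sub>+\<^sub>1 - y\<^sub>n\<bar>\<^sup>2\<close> has finite integral, hence is finite almost everywhere, and there
  the sequence converges.  Fatou's lemma transfers the distance estimates to the pointwise limit.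
\<close>

lemma L2_rapidly_Cauchy_convergent:
  fixes y :: "nat \<Rightarrow> 'a::euclidean_space \<Rightarrow> complex"
  assumes y: "\<And>n. square_integrable (y n)"
    and le: "\<And>n m. n \<le> m \<Longrightarrow> norm (abs_L2 (y m) - abs_L2 (y n)) \<le> (1 / 2) ^ n"
  shows "\<exists>f. \<forall>n. norm (f - abs_L2 (y n)) \<le> (1 / 2) ^ n"
proof -
  have [measurable]: "y n \<in> borel_measurable borel" for n
    using y by (rule square_integrable_measurable)
  have int: "(\<integral>\<^sup>+t. ennreal ((cmod (y m t - y n t))\<^sup>2) \<partial>lborel) \<le> ennreal (((1 / 2) ^ n)\<^sup>2)"
    if "n \<le> m" for n m
  proof -
    have "(norm (abs_L2 (\<lambda>t. y m t - y n t)))\<^sup>2 \<le> ((1 / 2) ^ n)\<^sup>2"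
      using le[OF that] by (intro power_mono) (auto simp: abs_L2_minus y)
    then show ?thesis
      by (subst nn_integral_square_eq_norm) (auto intro!: square_integrable_minus y ennreal_leI)
  qed
  define D where "D n t = 2 ^ n * (cmod (y (Suc n) t - y n t))\<^sup>2" for n t
  have D_meas [measurable]: "(\<lambda>t. D n t) \<in> borel_measurable borel" for n
    unfolding D_def by measurable
  have "(\<integral>\<^sup>+t. (\<Sum>n. ennreal (D n t)) \<partial>lborel) = (\<Sum>n. (\<integral>\<^sup>+t. ennreal (D n t) \<partial>lborel))"
    by (rule nn_integral_suminf) simp
  also have "\<dots> \<le> (\<Sum>n. ennreal ((1 / 2) ^ n))"
  proof (intro suminf_le summableI)
    fix n
    have "(\<integral>\<^sup>+t. ennreal (D n t) \<partial>lborel) =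
        ennreal (2 ^ n) * (\<integral>\<^sup>+t. ennreal ((cmod (y (Suc n) t - y n t))\<^sup>2) \<partial>lborel)"
      by (simp add: D_def ennreal_mult nn_integral_cmult)
    also have "\<dots> \<le> ennreal (2 ^ n) * ennreal (((1 / 2) ^ n)\<^sup>2)"
      by (intro mult_left_mono int) auto
    also have "\<dots> = ennreal ((1 / 2) ^ n)"
      by (subst ennreal_mult[symmetric]) (auto simp: power_divide power2_eq_square)
    finally show "(\<integral>\<^sup>+t. ennreal (D n t) \<partial>lborel) \<le> ennreal ((1 / 2) ^ n)" .
  qed
  also have "\<dots> = ennreal 2"
    by (subst suminf_ennreal2) (auto simp: suminf_geometric summable_geometric)
  finally have "(\<integral>\<^sup>+t. (\<Sum>n. ennreal (D n t)) \<partial>lborel) \<noteq> \<infinity>"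
    by (auto simp: top_unique)
  then have "AE t in lborel. (\<Sum>n. ennreal (D n t)) \<noteq> \<infinity>"
    by (intro nn_integral_PInf_AE) auto
  then have conv: "AE t in lborel. convergent (\<lambda>n. y n t)"
  proof eventually_elim
    case (elim t)
    then have "summable (\<lambda>n. D n t)"
      by (intro summable_suminf_not_top) (auto simp: D_def)
    then show ?case
      unfolding D_def
      by (intro convergent_of_summable_steps summable_norm_of_weighted_squares)
  qed
  define f where "f t = lim (\<lambda>n. y n t)" for t
  have [measurable]: "f \<in> borel_measurable borel"
    unfolding f_def by measurable
  have close: "(\<integral>\<^sup>+t. ennreal ((cmod (f t - y n t))\<^sup>2) \<partial>lborel) \<le> ennreal (((1 / 2) ^ n)\<^sup>2)" for n
  proof -
    have "AE t in lborel. ennreal ((cmod (f t - y n t))\<^sup>2)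
        = liminf (\<lambda>m. ennreal ((cmod (y m t - y n t))\<^sup>2))"
      using conv
    proof eventually_elim
      case (elim t)
      then have "(\<lambda>m. y m t) \<longlonglongrightarrow> f t"
        by (simp add: f_def convergent_LIMSEQ_iff)
      then have "(\<lambda>m. ennreal ((cmod (y m t - y n t))\<^sup>2)) \<longlonglongrightarrow> ennreal ((cmod (f t - y n t))\<^sup>2)"
        by (intro tendsto_intros tendsto_ennrealI)
      then show ?case
        by (intro lim_imp_Liminf[symmetric]) auto
    qed
    then have "(\<integral>\<^sup>+t. ennreal ((cmod (f t - y n t))\<^sup>2) \<partial>lborel)
        = (\<integral>\<^sup>+t. liminf (\<lambda>m. ennreal ((cmod (y m t - y n t))\<^sup>2)) \<partial>lborel)"
      by (rule nn_integral_cong_AE)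
    also have "\<dots> \<le> liminf (\<lambda>m. \<integral>\<^sup>+t. ennreal ((cmod (y m t - y n t))\<^sup>2) \<partial>lborel)"
      by (rule nn_integral_liminf) measurable
    also have "\<dots> \<le> liminf (\<lambda>m. ennreal (((1 / 2) ^ n)\<^sup>2))"
      by (intro Liminf_mono eventually_sequentiallyI[of n] int)
    finally show ?thesis by (simp add: Liminf_const)
  qed
  have sq: "square_integrable (\<lambda>t. f t - y n t)" "norm (abs_L2 (\<lambda>t. f t - y n t)) \<le> (1 / 2) ^ n" for n
    using norm_abs_L2_le[OF _ close[of n]] by auto
  have "square_integrable f"
    using square_integrable_add[OF sq(1)[of 0] y[of 0]] by simp
  then have "\<forall>n. norm (abs_L2 f - abs_L2 (y n)) \<le> (1 / 2) ^ n"
    using sq(2) by (simp add: abs_L2_minus y)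
  then show ?thesis ..
qed

instance L2 :: (euclidean_space) complete_space
proof
  fix X :: "nat \<Rightarrow> 'a L2"
  assume "Cauchy X"
  then have "\<forall>n. \<exists>M. \<forall>m\<ge>M. \<forall>k\<ge>M. dist (X m) (X k) < (1 / 2) ^ n"
    by (auto simp: Cauchy_def)
  then obtain N where N: "\<And>n m k. m \<ge> N n \<Longrightarrow> k \<ge> N n \<Longrightarrow> dist (X m) (X k) < (1 / 2) ^ n"
    by metis
  (* Partial sums dominate N and are monotone, so X along r is rapidly Cauchy. *)
  define r where "r n = (\<Sum>i\<le>n. N i)" for n
  have r: "N n \<le> r n" for n
    unfolding r_def by (rule member_le_sum) auto
  have r_mono: "r n \<le> r m" if "n \<le> m" for n m
    unfolding r_def using that by (intro sum_mono2) auto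
  have "\<exists>f. \<forall>n. norm (f - abs_L2 (rep_L2 (X (r n)))) \<le> (1 / 2) ^ n"
  proof (rule L2_rapidly_Cauchy_convergent)
    fix n m :: nat
    assume "n \<le> m"
    then have "dist (X (r m)) (X (r n)) < (1 / 2) ^ n"
      using r_mono[of n m] r[of n] by (intro N) auto
    then show "norm (abs_L2 (rep_L2 (X (r m))) - abs_L2 (rep_L2 (X (r n)))) \<le> (1 / 2) ^ n"
      by (simp add: abs_rep_L2 dist_norm)
  qed (rule square_integrable_rep_L2)
  then obtain f where f: "\<And>n. dist (X (r n)) f \<le> (1 / 2) ^ n"
    by (auto simp: abs_rep_L2 dist_norm norm_minus_commute)
  have "X \<longlonglongrightarrow> f"
  proof (rule metric_LIMSEQ_I)
    fix e :: real
    assume "0 < e"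
    then obtain n where n: "(1 / 2) ^ n < e / 2"
      using real_arch_pow_inv[of "e / 2" "1 / 2"] by auto
    have "dist (X m) f < e" if "m \<ge> N n" for m
      using dist_triangle[of "X m" f "X (r n)"] N[OF that r] f[of n] n by linarith
    then show "\<exists>no. \<forall>m\<ge>no. dist (X m) f < e" by blast
  qed
  then show "convergent X" by (auto simp: convergent_def)
qed

section \<open>Riesz representation\<close>

text \<open>
  The representing vector is the minimiser of \<open>x \<bullet> x - 2 * L x\<close>.  The parallelogram law makes every
  minimising sequence Cauchy, and the first-order condition at the limit \<open>y\<close> is \<open>L h = h \<bullet> y\<close>.
\<close>

lemma Riesz_representation:
  fixes L :: "'b::{real_inner, complete_space} \<Rightarrow> real"
  assumes "bounded_linear L"
  shows "\<exists>y. \<forall>x. L x = x \<bullet> y"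
proof -
  interpret L: bounded_linear L by fact
  obtain K where K: "\<And>x. \<bar>L x\<bar> \<le> norm x * K" using L.bounded by auto
  define J where "J x = x \<bullet> x - 2 * L x" for x
  have "- (K\<^sup>2) \<le> J x" for x
    using K[of x] zero_le_power2[of "norm x - K"]
    by (simp add: J_def power2_norm_eq_inner[symmetric] power2_diff)
  then have bdd: "bdd_below (range J)" by (rule bdd_belowI2)
  define m where "m = Inf (range J)"
  have m: "m \<le> J x" for x unfolding m_def using bdd by (rule cINF_lower) simp
  have "\<exists>x. J x < m + inverse (real (Suc n))" for n
    using cInf_less_iff[OF _ bdd, of "m + inverse (real (Suc n))"] by (auto simp: m_def)
  then obtain x where x: "\<And>n. J (x n) < m + inverse (real (Suc n))" by metis
  have par: "(norm (u - v))\<^sup>2 = 2 * J u + 2 * J v - 4 * J ((1/2) *\<^sub>R (u + v))" for u v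
    unfolding J_def power2_norm_eq_inner
    by (simp add: L.add L.scaleR algebra_simps inner_commute)
  have "Cauchy x"
  proof (rule metric_CauchyI)
    fix e :: real
    assume e: "0 < e"
    obtain N where N: "inverse (real (Suc N)) < e\<^sup>2 / 4"
      using reals_Archimedean[of "e\<^sup>2 / 4"] e by auto
    have "dist (x k) (x l) < e" if "k \<ge> N" "l \<ge> N" for k l
    proof -
      have inv: "inverse (real (Suc j)) \<le> inverse (real (Suc N))" if "j \<ge> N" for j
        using that by (simp add: field_simps)
      have "(norm (x k - x l))\<^sup>2 < e\<^sup>2"
        using par[of "x k" "x l"] m[of "(1/2) *\<^sub>R (x k + x l)"] x[of k] x[of l] N
          inv[OF that(1)] inv[OF that(2)] by linarith
      then show ?thesis
        using e by (auto simp: dist_norm intro: power2_less_imp_less)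
    qed
    then show "\<exists>M. \<forall>k\<ge>M. \<forall>l\<ge>M. dist (x k) (x l) < e" by blast
  qed
  then obtain y where y: "x \<longlonglongrightarrow> y"
    by (auto simp: Cauchy_convergent_iff convergent_def)
  have "(\<lambda>n. J (x n)) \<longlonglongrightarrow> J y"
    unfolding J_def by (intro tendsto_intros y L.tendsto)
  moreover have "(\<lambda>n. m + inverse (real (Suc n))) \<longlonglongrightarrow> m + 0"
    by (intro tendsto_intros LIMSEQ_inverse_real_of_nat)
  ultimately have "J y \<le> m + 0"
    by (rule LIMSEQ_le) (use x in \<open>blast intro: less_imp_le\<close>)
  have "L h = h \<bullet> y" for h
  proof (cases "h = 0")
    case False
    define t where "t = - (y \<bullet> h - L h) / (h \<bullet> h)"
    have hh: "h \<bullet> h > 0" using False by simp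
    have "J y \<le> J (y + t *\<^sub>R h)"
      using m[of "y + t *\<^sub>R h"] \<open>J y \<le> m + 0\<close> by linarith
    also have "\<dots> = J y + (t\<^sup>2 * (h \<bullet> h) + 2 * t * (y \<bullet> h - L h))"
      by (simp add: J_def L.add L.scaleR algebra_simps inner_commute power2_eq_square)
    also have "t\<^sup>2 * (h \<bullet> h) + 2 * t * (y \<bullet> h - L h) = - ((y \<bullet> h - L h)\<^sup>2 / (h \<bullet> h))"
      using hh by (simp add: t_def field_simps power2_eq_square)
    finally have "(y \<bullet> h - L h)\<^sup>2 / (h \<bullet> h) \<le> 0" by simp
    then have "y \<bullet> h - L h = 0"
      using hh by (simp add: divide_le_0_iff)
    then show ?thesis by (simp add: inner_commute)
  qed (simp add: L.zero)
  then show ?thesis by blast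
qed

section \<open>Translation and truncation\<close>

lemma nn_integral_lborel_translate:
  fixes c :: "'a::euclidean_space"
  assumes [measurable]: "f \<in> borel_measurable borel"
  shows "(\<integral>\<^sup>+t. f (c + t) \<partial>lborel) = (\<integral>\<^sup>+t. f t \<partial>lborel)"
proof -
  have "(\<integral>\<^sup>+t. f t \<partial>lborel) = (\<integral>\<^sup>+t. f t \<partial>distr lborel borel ((+) c))"
    by (simp only: lborel_distr_plus)
  also have "\<dots> = (\<integral>\<^sup>+t. f (c + t) \<partial>lborel)"
    by (rule nn_integral_distr) auto
  finally show ?thesis ..
qed

lemma integral_lborel_translate:
  fixes c :: "'a::euclidean_space" and f :: "'a \<Rightarrow> complex"
  assumes [measurable]: "f \<in> borel_measurable borel"
  shows "(\<integral>t. f (c + t) \<partial>lborel) = (\<integral>t. f t \<partial>lborel)"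
proof -
  have "(\<integral>t. f t \<partial>lborel) = (\<integral>t. f t \<partial>distr lborel borel ((+) c))"
    by (simp only: lborel_distr_plus)
  also have "\<dots> = (\<integral>t. f (c + t) \<partial>lborel)"
    by (rule integral_distr) auto
  finally show ?thesis ..
qed

text \<open>
  The truncations of a square-integrable function are integrable and converge to it, which makes
  the functions in \<open>L\<^sup>1 \<inter> L\<^sup>2\<close> dense in \<open>L\<^sup>2\<close>.
\<close>

definition truncate :: "nat \<Rightarrow> ('a::euclidean_space \<Rightarrow> complex) \<Rightarrow> 'a \<Rightarrow> complex" where
  "truncate n f t = (if norm t \<le> real n then f t else 0)"

lemma truncate_measurable [measurable]:
  assumes [measurable]: "f \<in> borel_measurable borel"
  shows "truncate n f \<in> borel_measurable borel"
  unfolding truncate_def[abs_def] by measurable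

lemma square_integrable_truncate:
  assumes "square_integrable f"
  shows "square_integrable (truncate n f)"
proof (rule square_integrable_dominated[OF _ assms])
  show "truncate n f \<in> borel_measurable borel"
    using assms by (intro truncate_measurable square_integrable_measurable)
qed (simp add: truncate_def)

text \<open>
  Truncation is multiplication by the indicator of a ball, which is itself in \<open>L\<^sup>2\<close>.
\<close>

lemma integrable_truncate:
  fixes f :: "'a::euclidean_space \<Rightarrow> complex"
  assumes "square_integrable f"
  shows "integrable lborel (truncate n f)"
proof -
  let ?i = "\<lambda>t :: 'a. indicator (cball 0 (real n)) t :: complex"
  have "integrable lborel (indicator (cball (0 :: 'a) (real n)) :: 'a \<Rightarrow> real)"
    by (rule integrable_real_indicator) (use emeasure_bounded_finite[OF bounded_cball] in \<open>auto\<close>)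
  moreover have "(cmod (?i t))\<^sup>2 = indicator (cball 0 (real n)) t" for t :: 'a
    by (simp add: indicator_def)
  ultimately have "square_integrable ?i"
    unfolding square_integrable_def by (simp add: borel_measurable_indicator)
  from integrable_mult_cnj[OF assms this] show ?thesis
    by (rule Bochner_Integration.integrable_cong[THEN iffD1, rotated 2])
      (auto simp: truncate_def indicator_def)
qed

lemma abs_L2_truncate_tendsto:
  fixes f :: "'a::euclidean_space \<Rightarrow> complex"
  assumes f: "square_integrable f"
  shows "(\<lambda>n. abs_L2 (truncate n f)) \<longlonglongrightarrow> abs_L2 f"
proof -
  have [measurable]: "f \<in> borel_measurable borel"
    using f by (rule square_integrable_measurable)
  have "(\<lambda>n. \<integral>t. (cmod (truncate n f t - f t))\<^sup>2 \<partial>lborel) \<longlonglongrightarrow> (\<integral>t. 0 \<partial>(lborel :: 'a measure))"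
  proof (rule integral_dominated_convergence)
    show "integrable lborel (\<lambda>t. (cmod (f t))\<^sup>2)"
      using f by (simp add: square_integrable_def)
    show "AE t in lborel. (\<lambda>n. (cmod (truncate n f t - f t))\<^sup>2) \<longlonglongrightarrow> 0"
    proof (rule AE_I2)
      fix t :: 'a
      obtain N :: nat where N: "norm t \<le> real N" using real_arch_simple by blast
      show "(\<lambda>n. (cmod (truncate n f t - f t))\<^sup>2) \<longlonglongrightarrow> 0"
        by (rule tendsto_eventually, rule eventually_sequentiallyI[of N])
          (use N in \<open>auto simp: truncate_def\<close>)
    qed
  qed (auto simp: truncate_def)
  then have "(\<lambda>n. (norm (abs_L2 (truncate n f) - abs_L2 f))\<^sup>2) \<longlonglongrightarrow> 0"
    by (simp add: abs_L2_minus f square_integrable_truncate norm_abs_L2_square square_integrable_minus)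
  then have "(\<lambda>n. sqrt ((norm (abs_L2 (truncate n f) - abs_L2 f))\<^sup>2)) \<longlonglongrightarrow> sqrt 0"
    by (rule tendsto_real_sqrt)
  then show ?thesis
    by (simp add: tendsto_norm_zero_iff LIM_zero_iff)
qed

section \<open>The Fourier integral of a Gaussian\<close>

lemma cis_measurable [measurable]: "cis \<in> borel_measurable borel"
proof -
  have "cis = (\<lambda>y. exp (\<i> * complex_of_real y))" by (simp add: cis_conv_exp fun_eq_iff)
  then show ?thesis by (auto intro!: borel_measurable_continuous_onI continuous_intros)
qed

text \<open>
  Lebesgue measure is the image of a product measure over the standard basis, so integrals of
  functions that factor along the coordinates factor too.
\<close>

lemma lborel_integral_prod:
  fixes h :: "'a::euclidean_space \<Rightarrow> real \<Rightarrow> complex"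
  assumes h: "\<And>b. b \<in> Basis \<Longrightarrow> integrable lborel (h b)"
  shows "integrable lborel (\<lambda>x::'a. \<Prod>b\<in>Basis. h b (x \<bullet> b))" (is ?int)
    and "(\<integral>x. (\<Prod>b\<in>Basis. h b ((x :: 'a) \<bullet> b)) \<partial>lborel) = (\<Prod>b\<in>Basis. \<integral>x. h b x \<partial>lborel)" (is ?eq)
proof -
  interpret product_sigma_finite "\<lambda>b::'a. lborel :: real measure" ..
  have [measurable]: "h b \<in> borel_measurable borel" if "b \<in> Basis" for b
    using borel_measurable_integrable[OF h[OF that]] by simp
  let ?T = "\<lambda>f::'a \<Rightarrow> real. \<Sum>b\<in>Basis. f b *\<^sub>R b"
  have T [measurable]: "?T \<in> measurable (\<Pi>\<^sub>M b\<in>Basis. lborel) borel"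
    by measurable
  have comp: "(\<Prod>b\<in>Basis. h b (?T f \<bullet> b)) = (\<Prod>b\<in>Basis. h b (f b))" for f
    by (rule prod.cong) (auto simp: inner_sum_left_Basis)
  have meas: "(\<lambda>x::'a. \<Prod>b\<in>Basis. h b (x \<bullet> b)) \<in> borel_measurable borel"
    by measurable
  show ?int
    by (subst lborel_eq, subst integrable_distr_eq[OF T meas], unfold comp)
      (intro product_integrable_prod h finite_Basis)
  show ?eq
    by (subst lborel_eq, subst integral_distr[OF T meas], unfold comp)
      (intro product_integral_prod h finite_Basis)
qed

text \<open>
  The case \<open>2 \<pi> c = 1\<close> is the characteristic function of the standard normal distribution; the
  general case is a rescaling by \<open>\<sigma> = sqrt (2 \<pi> c)\<close>.
\<close>

lemma gaussian_fourier_real: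
  fixes c u :: real
  assumes c: "c > 0"
  shows "integrable lborel (\<lambda>x. complex_of_real (exp (- (pi * c * x\<^sup>2))) * cis (- (2 * pi * (x * u))))"
      (is "integrable _ ?g")
    and "(\<integral>x. complex_of_real (exp (- (pi * c * x\<^sup>2))) * cis (- (2 * pi * (x * u))) \<partial>lborel)
       = complex_of_real (exp (- (pi * u\<^sup>2 / c)) / sqrt c)"
proof -
  define \<sigma> where "\<sigma> = sqrt (2 * pi * c)"
  have \<sigma>: "\<sigma> > 0" "\<sigma>\<^sup>2 = 2 * pi * c" using c by (auto simp: \<sigma>_def)
  define s where "s = - (2 * pi * u / \<sigma>)"
  let ?k = "\<lambda>x. std_normal_density x *\<^sub>R iexp (s * x)"
  have "integrable lborel ?k"
  proof (rule Bochner_Integration.integrable_bound[of lborel std_normal_density])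
    show "integrable lborel std_normal_density"
      using integrable_std_normal_moment[of 0] by simp
  qed auto
  then have k: "has_bochner_integral lborel ?k (integral\<^sup>L lborel ?k)"
    by (rule has_bochner_integral_integrable)
  have "integral\<^sup>L lborel ?k = char std_normal_distribution s"
    unfolding char_def by (subst integral_density) auto
  also have "\<dots> = complex_of_real (exp (- (pi * u\<^sup>2 / c)))"
    using c \<sigma> by (simp add: char_std_normal_distribution s_def power_divide power_mult_distrib
        power2_eq_square[of pi] field_simps)
  finally have "has_bochner_integral lborel ?k (complex_of_real (exp (- (pi * u\<^sup>2 / c))))"
    using k by simp
  then have "has_bochner_integral lborel (\<lambda>x. ?k (0 + \<sigma> * x))
      (complex_of_real (exp (- (pi * u\<^sup>2 / c))) /\<^sub>R \<bar>\<sigma>\<bar>)"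
    using \<sigma> by (subst (asm) lborel_has_bochner_integral_real_affine_iff[of \<sigma> _ _ 0]) auto
  then have "has_bochner_integral lborel (\<lambda>x. complex_of_real (sqrt (2 * pi)) * ?k (0 + \<sigma> * x))
      (complex_of_real (sqrt (2 * pi)) * (complex_of_real (exp (- (pi * u\<^sup>2 / c))) /\<^sub>R \<bar>\<sigma>\<bar>))"
    by (intro has_bochner_integral_mult_right)
  also have "(\<lambda>x. complex_of_real (sqrt (2 * pi)) * ?k (0 + \<sigma> * x)) = ?g"
  proof
    fix x
    have "s * (\<sigma> * x) = - (2 * pi * (x * u))"
      using \<sigma> by (simp add: s_def)
    moreover have "(\<sigma> * x)\<^sup>2 = 2 * (pi * c * x\<^sup>2)"
      using \<sigma> by (simp add: power_mult_distrib)
    ultimately show "complex_of_real (sqrt (2 * pi)) * ?k (0 + \<sigma> * x) = ?g x"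
      by (simp add: std_normal_density_def scaleR_conv_of_real cis_conv_exp mult.assoc)
  qed
  also have "complex_of_real (sqrt (2 * pi)) * (complex_of_real (exp (- (pi * u\<^sup>2 / c))) /\<^sub>R \<bar>\<sigma>\<bar>)
      = complex_of_real (exp (- (pi * u\<^sup>2 / c)) / sqrt c)"
    using c by (simp add: \<sigma>_def scaleR_conv_of_real real_sqrt_mult field_simps)
  finally have *: "has_bochner_integral lborel ?g (complex_of_real (exp (- (pi * u\<^sup>2 / c)) / sqrt c))" .
  show "integrable lborel ?g" using * by (rule integrable.intros)
  show "integral\<^sup>L lborel ?g = complex_of_real (exp (- (pi * u\<^sup>2 / c)) / sqrt c)"
    using * by (rule has_bochner_integral_integral_eq)
qed

definition gaussian :: "real \<Rightarrow> 'a::euclidean_space \<Rightarrow> real" where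
  "gaussian c t = exp (- (pi * c * (t \<bullet> t)))"

lemma gaussian_measurable [measurable]: "gaussian c \<in> borel_measurable borel"
  unfolding gaussian_def by measurable

lemma gaussian_pos: "gaussian c t > 0"
  by (simp add: gaussian_def)

lemma gaussian_prod:
  fixes t \<omega> :: "'a::euclidean_space"
  shows "complex_of_real (gaussian c t) * cis (- (2 * pi * (\<omega> \<bullet> t)))
    = (\<Prod>b\<in>Basis. complex_of_real (exp (- (pi * c * (t \<bullet> b)\<^sup>2))) * cis (- (2 * pi * ((t \<bullet> b) * (\<omega> \<bullet> b)))))"
proof -
  have "complex_of_real (gaussian c t) * cis (- (2 * pi * (\<omega> \<bullet> t))) =
      exp (complex_of_real (- (pi * c * (t \<bullet> t))) + \<i> * complex_of_real (- (2 * pi * (\<omega> \<bullet> t))))"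
    unfolding gaussian_def cis_conv_exp exp_add exp_of_real[symmetric] ..
  also have "complex_of_real (- (pi * c * (t \<bullet> t))) + \<i> * complex_of_real (- (2 * pi * (\<omega> \<bullet> t)))
     = (\<Sum>b\<in>Basis. complex_of_real (- (pi * c * (t \<bullet> b)\<^sup>2)) + \<i> * complex_of_real (- (2 * pi * ((t \<bullet> b) * (\<omega> \<bullet> b)))))"
    unfolding euclidean_inner[of t t] euclidean_inner[of \<omega> t]
    by (simp add: sum.distrib sum_distrib_left sum_negf sum_subtractf power2_eq_square mult_ac)
  also have "exp \<dots> = (\<Prod>b\<in>Basis. complex_of_real (exp (- (pi * c * (t \<bullet> b)\<^sup>2))) * cis (- (2 * pi * ((t \<bullet> b) * (\<omega> \<bullet> b)))))"
    unfolding exp_sum[OF finite_Basis] cis_conv_exp exp_add exp_of_real[symmetric] ..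
  finally show ?thesis .
qed

lemma fourier_integral_gaussian:
  fixes \<omega> :: "'a::euclidean_space"
  assumes c: "c > 0"
  shows "fourier_integral (\<lambda>t. complex_of_real (gaussian c t)) \<omega>
    = complex_of_real (gaussian (1 / c) \<omega> / sqrt c ^ DIM('a))"
proof -
  have "fourier_integral (\<lambda>t. complex_of_real (gaussian c t)) \<omega>
    = (\<Prod>b\<in>Basis. \<integral>x. complex_of_real (exp (- (pi * c * x\<^sup>2))) * cis (- (2 * pi * (x * (\<omega> \<bullet> b)))) \<partial>lborel)"
    unfolding fourier_integral_def gaussian_prod
    by (rule lborel_integral_prod(2)) (rule gaussian_fourier_real(1)[OF c])
  also have "\<dots> = (\<Prod>b\<in>Basis. complex_of_real (exp (- (pi * (\<omega> \<bullet> b)\<^sup>2 / c)) / sqrt c))"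
    by (simp only: gaussian_fourier_real(2)[OF c])
  also have "\<dots> = complex_of_real ((\<Prod>b\<in>Basis. exp (- (pi * (\<omega> \<bullet> b)\<^sup>2 / c))) / sqrt c ^ DIM('a))"
    by (simp add: prod_dividef)
  also have "(\<Prod>b\<in>Basis. exp (- (pi * (\<omega> \<bullet> b)\<^sup>2 / c))) = gaussian (1 / c) \<omega>"
    unfolding gaussian_def euclidean_inner[of \<omega> \<omega>]
    by (simp add: exp_sum[symmetric] sum_negf sum_divide_distrib sum_distrib_left power2_eq_square)
  finally show ?thesis .
qed

lemma integrable_gaussian:
  assumes c: "c > 0"
  shows "integrable lborel (gaussian c :: 'a::euclidean_space \<Rightarrow> real)"
proof -
  have "integrable lborel (\<lambda>t::'a. complex_of_real (gaussian c t) * cis (- (2 * pi * (0 \<bullet> t))))"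
    unfolding gaussian_prod
    by (rule lborel_integral_prod(1)) (rule gaussian_fourier_real(1)[OF c])
  then show ?thesis
    by (simp add: complex_of_real_integrable_eq)
qed

lemma nn_integral_gaussian:
  assumes c: "c > 0"
  shows "(\<integral>\<^sup>+t. ennreal (gaussian c (t :: 'a::euclidean_space)) \<partial>lborel) = ennreal (1 / sqrt c ^ DIM('a))"
proof -
  have "complex_of_real (\<integral>t. gaussian c (t :: 'a) \<partial>lborel) = fourier_integral (\<lambda>t::'a. complex_of_real (gaussian c t)) 0"
    by (simp add: fourier_integral_def)
  also have "\<dots> = complex_of_real (1 / sqrt c ^ DIM('a))"
    by (subst fourier_integral_gaussian[OF c]) (simp add: gaussian_def)
  finally have "(\<integral>t. gaussian c (t :: 'a) \<partial>lborel) = 1 / sqrt c ^ DIM('a)"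
    unfolding of_real_eq_iff .
  then show ?thesis
    by (subst nn_integral_eq_integral) (auto simp: integrable_gaussian c less_imp_le gaussian_pos)
qed

section \<open>The Fourier integral contracts the square norm\<close>

lemma fourier_integral_measurable [measurable]:
  fixes f :: "'a::euclidean_space \<Rightarrow> complex"
  assumes [measurable]: "f \<in> borel_measurable borel"
  shows "fourier_integral f \<in> borel_measurable borel"
proof -
  have "(\<lambda>\<omega>. \<integral>t. f t * cis (- (2 * pi * (\<omega> \<bullet> t))) \<partial>lborel) \<in> borel_measurable borel"
    by (rule lborel.borel_measurable_lebesgue_integral) measurable
  then show ?thesis by (simp add: fourier_integral_def[abs_def])
qed

lemma cmod_fourier_integral_le:
  "cmod (fourier_integral f \<omega>) \<le> (\<integral>t. cmod (f t) \<partial>lborel)"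
  unfolding fourier_integral_def
  by (rule order_trans[OF integral_norm_bound]) (simp add: norm_mult)

lemma integrable_cis_mult:
  fixes f :: "'a::euclidean_space \<Rightarrow> complex"
  assumes "integrable lborel f" "g \<in> borel_measurable borel"
  shows "integrable lborel (\<lambda>t. f t * cis (g t))"
proof -
  have [measurable]: "f \<in> borel_measurable borel" "g \<in> borel_measurable borel"
    using assms by auto
  show ?thesis
    by (rule Bochner_Integration.integrable_bound[OF assms(1)]) (auto simp: norm_mult)
qed

text \<open>
  Both sides are the double integral of \<open>f t * h \<omega> * exp (- 2 \<pi> i \<omega> \<bullet> t)\<close>, which converges
  absolutely.
\<close>

lemma fourier_integral_multiplication:
  fixes f h :: "'a::euclidean_space \<Rightarrow> complex"
  assumes f: "integrable lborel f" and h: "integrable lborel h"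
  shows "(\<integral>\<omega>. fourier_integral f \<omega> * h \<omega> \<partial>lborel) = (\<integral>t. f t * fourier_integral h t \<partial>lborel)"
proof -
  have [measurable]: "f \<in> borel_measurable borel" "h \<in> borel_measurable borel"
    using f h by auto
  let ?k = "\<lambda>t \<omega>. f t * h \<omega> * cis (- (2 * pi * (\<omega> \<bullet> t)))"
  have "integrable (lborel \<Otimes>\<^sub>M lborel) (case_prod ?k)"
  proof (rule lborel_pair.Fubini_integrable)
    show "case_prod ?k \<in> borel_measurable (lborel \<Otimes>\<^sub>M lborel)"
      by measurable
    show "integrable lborel (\<lambda>t. \<integral>\<omega>. norm (case_prod ?k (t, \<omega>)) \<partial>lborel)"
      using f by (simp add: norm_mult)
    show "AE t in lborel. integrable lborel (\<lambda>\<omega>. case_prod ?k (t, \<omega>))"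
      using integrable_cis_mult[OF h] by (simp add: mult.assoc)
  qed
  then have "(\<integral>\<omega>. (\<integral>t. ?k t \<omega> \<partial>lborel) \<partial>lborel) = (\<integral>t. (\<integral>\<omega>. ?k t \<omega> \<partial>lborel) \<partial>lborel)"
    by (rule lborel_pair.Fubini_integral)
  moreover have "(\<integral>t. ?k t \<omega> \<partial>lborel) = fourier_integral f \<omega> * h \<omega>" for \<omega>
    unfolding fourier_integral_def integral_mult_left_zero[symmetric] by (simp add: mult_ac)
  moreover have "(\<integral>\<omega>. ?k t \<omega> \<partial>lborel) = f t * fourier_integral h t" for t
    unfolding fourier_integral_def integral_mult_right_zero[symmetric]
    by (simp add: mult_ac inner_commute)
  ultimately show ?thesis by simp
qed

lemma fourier_integral_modulation:
  "fourier_integral (\<lambda>t. cis (2 * pi * (\<xi> \<bullet> t)) * f t) \<omega> = fourier_integral f (\<omega> - \<xi>)"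
proof -
  have "cis (2 * pi * (\<xi> \<bullet> t)) * f t * cis (- (2 * pi * (\<omega> \<bullet> t)))
      = f t * cis (- (2 * pi * ((\<omega> - \<xi>) \<bullet> t)))" for t
  proof -
    have "cis (2 * pi * (\<xi> \<bullet> t)) * cis (- (2 * pi * (\<omega> \<bullet> t))) = cis (- (2 * pi * ((\<omega> - \<xi>) \<bullet> t)))"
      by (simp only: cis_mult) (simp add: inner_diff_left algebra_simps)
    then show ?thesis by (simp add: mult_ac)
  qed
  then show ?thesis by (simp only: fourier_integral_def)
qed

lemma ennreal_norm_integral_le:
  fixes f :: "'a \<Rightarrow> 'b::{banach, second_countable_topology}"
  shows "ennreal (norm (integral\<^sup>L M f)) \<le> (\<integral>\<^sup>+x. ennreal (norm (f x)) \<partial>M)"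
  by (cases "integrable M f") (simp_all add: integral_norm_bound_ennreal not_integrable_integral_eq)

text \<open>
  The Fourier integral of \<open>gaussian c\<close>: a nonnegative even function of total mass one, the heat
  kernel at time \<open>c / (4 \<pi>)\<close>.
\<close>

definition heat_kernel :: "real \<Rightarrow> 'a::euclidean_space \<Rightarrow> real" where
  "heat_kernel c u = gaussian (1 / c) u / sqrt c ^ DIM('a)"

lemma heat_kernel_measurable [measurable]: "heat_kernel c \<in> borel_measurable borel"
  unfolding heat_kernel_def[abs_def] by measurable

lemma heat_kernel_nonneg: "c > 0 \<Longrightarrow> heat_kernel c u \<ge> 0"
  by (simp add: heat_kernel_def less_imp_le gaussian_pos)

lemma heat_kernel_minus: "heat_kernel c (- u) = heat_kernel c u"
  by (simp add: heat_kernel_def gaussian_def)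

lemma nn_integral_heat_kernel:
  fixes t :: "'a::euclidean_space"
  assumes c: "c > 0"
  shows "(\<integral>\<^sup>+s. ennreal (heat_kernel c (s - t)) \<partial>lborel) = 1"
proof -
  have "(\<integral>\<^sup>+s. ennreal (heat_kernel c (s - t)) \<partial>lborel) = (\<integral>\<^sup>+s. ennreal (heat_kernel c (s :: 'a)) \<partial>lborel)"
    using nn_integral_lborel_translate[of "\<lambda>s. ennreal (heat_kernel c s)" "- t"] by simp
  also have "\<dots> = (\<integral>\<^sup>+s. ennreal (1 / sqrt c ^ DIM('a)) * ennreal (gaussian (1 / c) (s :: 'a)) \<partial>lborel)"
    using c by (intro nn_integral_cong) (simp add: heat_kernel_def ennreal_mult[symmetric] less_imp_le gaussian_pos)
  also have "\<dots> = ennreal (1 / sqrt c ^ DIM('a)) * ennreal (1 / sqrt (1 / c) ^ DIM('a))"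
    using c by (subst nn_integral_cmult) (simp_all add: nn_integral_gaussian)
  also have "\<dots> = 1"
    using c by (subst ennreal_mult[symmetric]) (simp_all add: real_sqrt_divide power_divide)
  finally show ?thesis .
qed

text \<open>
  Damping \<open>\<bar>\<F> f\<bar>\<^sup>2\<close> by a Gaussian makes it integrable.  Two uses of the multiplication formula then
  turn the integral into a quadratic form in \<open>f\<close> whose kernel is the Fourier integral of the damping
  factor.
\<close>

lemma gaussian_regularised_fourier_norm:
  fixes f :: "'a::euclidean_space \<Rightarrow> complex"
  assumes f: "integrable lborel f" and c: "c > 0"
  shows "integrable lborel (\<lambda>\<omega>. (cmod (fourier_integral f \<omega>))\<^sup>2 * gaussian c \<omega>)"
    and "complex_of_real (\<integral>\<omega>. (cmod (fourier_integral f \<omega>))\<^sup>2 * gaussian c \<omega> \<partial>lborel)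
       = (\<integral>t. f t * cnj (\<integral>s. f s * heat_kernel c (s - t) \<partial>lborel) \<partial>lborel)"
proof -
  have [measurable]: "f \<in> borel_measurable borel"
    using f by auto
  let ?F = "fourier_integral f"
  define B where "B = (\<integral>t. cmod (f t) \<partial>lborel)"
  have B: "cmod (?F \<omega>) \<le> B" for \<omega>
    unfolding B_def by (rule cmod_fourier_integral_le)
  have "0 \<le> B" using B[of 0] norm_ge_zero[of "?F 0"] by linarith
  have gB: "integrable lborel (\<lambda>\<omega>::'a. K * gaussian c \<omega>)" for K :: real
    by (intro integrable_mult_right integrable_gaussian c)
  show "integrable lborel (\<lambda>\<omega>. (cmod (?F \<omega>))\<^sup>2 * gaussian c \<omega>)"
    using B \<open>0 \<le> B\<close> by (intro Bochner_Integration.integrable_bound[OF gB[of "B\<^sup>2"]])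
      (auto simp: abs_mult gaussian_pos less_imp_le intro!: mult_right_mono power_mono AE_I2)
  (* The damped integrand is ?F \<omega> * h \<omega>; the first use of the multiplication formula moves the
     Fourier integral from f to h, the second evaluates the Fourier integral of h. *)
  define h where "h \<omega> = cnj (?F \<omega>) * complex_of_real (gaussian c \<omega>)" for \<omega>
  have h: "integrable lborel h"
    unfolding h_def using B by (intro Bochner_Integration.integrable_bound[OF gB[of B]])
      (auto simp: norm_mult \<open>0 \<le> B\<close> gaussian_pos less_imp_le intro!: mult_right_mono AE_I2)
  have "complex_of_real (\<integral>\<omega>. (cmod (?F \<omega>))\<^sup>2 * gaussian c \<omega> \<partial>lborel)
      = (\<integral>\<omega>. ?F \<omega> * h \<omega> \<partial>lborel)"
    unfolding integral_complex_of_real[symmetric] h_def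
    by (simp only: of_real_mult complex_norm_square mult.assoc)
  also have "\<dots> = (\<integral>t. f t * fourier_integral h t \<partial>lborel)"
    by (rule fourier_integral_multiplication[OF f h])
  also have "\<dots> = (\<integral>t. f t * cnj (\<integral>s. f s * heat_kernel c (s - t) \<partial>lborel) \<partial>lborel)"
  proof (rule Bochner_Integration.integral_cong[OF refl])
    fix t :: 'a
    let ?m = "\<lambda>\<omega>. cis (2 * pi * (t \<bullet> \<omega>)) * complex_of_real (gaussian c \<omega>)"
    have m: "integrable lborel ?m"
      by (subst mult.commute, intro integrable_cis_mult)
        (auto simp: complex_of_real_integrable_eq integrable_gaussian c)
    have "fourier_integral h t = cnj (\<integral>\<omega>. ?F \<omega> * ?m \<omega> \<partial>lborel)"
      unfolding fourier_integral_def[of h] h_def Bochner_Integration.integral_cnj[symmetric]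
      by (simp add: cis_cnj mult_ac)
    also have "(\<integral>\<omega>. ?F \<omega> * ?m \<omega> \<partial>lborel) = (\<integral>s. f s * fourier_integral ?m s \<partial>lborel)"
      by (rule fourier_integral_multiplication[OF f m])
    also have "\<dots> = (\<integral>s. f s * heat_kernel c (s - t) \<partial>lborel)"
      by (simp add: fourier_integral_modulation fourier_integral_gaussian[OF c] heat_kernel_def)
    finally show "f t * fourier_integral h t = f t * cnj (\<integral>s. f s * heat_kernel c (s - t) \<partial>lborel)"
      by simp
  qed
  finally show "complex_of_real (\<integral>\<omega>. (cmod (?F \<omega>))\<^sup>2 * gaussian c \<omega> \<partial>lborel)
       = (\<integral>t. f t * cnj (\<integral>s. f s * heat_kernel c (s - t) \<partial>lborel) \<partial>lborel)" .
qed

text \<open>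
  In the quadratic form, \<open>\<bar>f t\<bar> \<bar>f s\<bar>\<close> is at most the mean of \<open>\<bar>f t\<bar>\<^sup>2\<close> and \<open>\<bar>f s\<bar>\<^sup>2\<close>, and the
  kernel integrates to one in each variable (Schur's test).
\<close>

lemma gaussian_regularised_fourier_norm_le:
  fixes f :: "'a::euclidean_space \<Rightarrow> complex"
  assumes f: "integrable lborel f" and c: "c > 0"
  shows "(\<integral>\<^sup>+\<omega>. ennreal ((cmod (fourier_integral f \<omega>))\<^sup>2 * gaussian c \<omega>) \<partial>lborel)
    \<le> (\<integral>\<^sup>+t. ennreal ((cmod (f t))\<^sup>2) \<partial>lborel)"
proof -
  have [measurable]: "f \<in> borel_measurable borel"
    using f by auto
  let ?I = "\<integral>\<omega>. (cmod (fourier_integral f \<omega>))\<^sup>2 * gaussian c \<omega> \<partial>lborel"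
  let ?H = "\<lambda>s t. ennreal (heat_kernel c (s - t))"
  let ?q = "\<lambda>t. ennreal ((cmod (f t))\<^sup>2)"
  have "0 \<le> ?I" by (intro integral_nonneg_AE AE_I2) (simp add: gaussian_pos less_imp_le)
  then have "ennreal ?I = ennreal (cmod (complex_of_real ?I))" by simp
  also have "\<dots> = ennreal (cmod (\<integral>t. f t * cnj (\<integral>s. f s * heat_kernel c (s - t) \<partial>lborel) \<partial>lborel))"
    by (simp only: gaussian_regularised_fourier_norm(2)[OF f c])
  also have "\<dots> \<le> (\<integral>\<^sup>+t. ennreal (cmod (f t * cnj (\<integral>s. f s * heat_kernel c (s - t) \<partial>lborel))) \<partial>lborel)"
    by (rule ennreal_norm_integral_le)
  also have "\<dots> \<le> (\<integral>\<^sup>+t. (\<integral>\<^sup>+s. ennreal (cmod (f t)) * (ennreal (cmod (f s)) * ?H s t) \<partial>lborel) \<partial>lborel)"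
  proof (rule nn_integral_mono)
    fix t
    have "ennreal (cmod (\<integral>s. f s * heat_kernel c (s - t) \<partial>lborel))
        \<le> (\<integral>\<^sup>+s. ennreal (cmod (f s * heat_kernel c (s - t))) \<partial>lborel)"
      by (rule ennreal_norm_integral_le)
    also have "\<dots> = (\<integral>\<^sup>+s. ennreal (cmod (f s)) * ?H s t \<partial>lborel)"
      by (simp add: norm_mult ennreal_mult heat_kernel_nonneg[OF c])
    finally have "ennreal (cmod (f t)) * ennreal (cmod (\<integral>s. f s * heat_kernel c (s - t) \<partial>lborel))
        \<le> ennreal (cmod (f t)) * (\<integral>\<^sup>+s. ennreal (cmod (f s)) * ?H s t \<partial>lborel)"
      by (intro mult_left_mono) auto
    then show "ennreal (cmod (f t * cnj (\<integral>s. f s * heat_kernel c (s - t) \<partial>lborel)))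
        \<le> (\<integral>\<^sup>+s. ennreal (cmod (f t)) * (ennreal (cmod (f s)) * ?H s t) \<partial>lborel)"
      by (simp add: norm_mult ennreal_mult nn_integral_cmult)
  qed
  also have "\<dots> \<le> (\<integral>\<^sup>+t. (\<integral>\<^sup>+s. ennreal (1/2) * (?q t * ?H s t) + ennreal (1/2) * (?q s * ?H s t) \<partial>lborel) \<partial>lborel)"
  proof (intro nn_integral_mono)
    fix t s
    have "cmod (f t) * cmod (f s) * heat_kernel c (s - t)
      \<le> (1/2 * (cmod (f t))\<^sup>2 + 1/2 * (cmod (f s))\<^sup>2) * heat_kernel c (s - t)"
      using sum_squares_bound[of "cmod (f t)" "cmod (f s)"]
      by (intro mult_right_mono heat_kernel_nonneg[OF c]) auto
    then have "ennreal (cmod (f t) * cmod (f s) * heat_kernel c (s - t))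
      \<le> ennreal (1/2 * ((cmod (f t))\<^sup>2 * heat_kernel c (s - t)) + 1/2 * ((cmod (f s))\<^sup>2 * heat_kernel c (s - t)))"
      by (intro ennreal_leI) (simp add: algebra_simps)
    moreover have "ennreal (1/2 * ((cmod (f t))\<^sup>2 * heat_kernel c (s - t)) + 1/2 * ((cmod (f s))\<^sup>2 * heat_kernel c (s - t)))
      = ennreal (1/2) * (?q t * ?H s t) + ennreal (1/2) * (?q s * ?H s t)"
      using heat_kernel_nonneg[OF c, of "s - t"]
      by (subst ennreal_plus) (simp_all only: ennreal_mult zero_le_power2 mult_nonneg_nonneg zero_le_divide_1_iff zero_le_numeral)
    moreover have "ennreal (cmod (f t)) * (ennreal (cmod (f s)) * ?H s t)
      = ennreal (cmod (f t) * cmod (f s) * heat_kernel c (s - t))"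
      using heat_kernel_nonneg[OF c, of "s - t"] by (simp add: ennreal_mult mult.assoc)
    ultimately show "ennreal (cmod (f t)) * (ennreal (cmod (f s)) * ?H s t)
      \<le> ennreal (1/2) * (?q t * ?H s t) + ennreal (1/2) * (?q s * ?H s t)"
      by simp
  qed
  also have "\<dots> = ennreal (1/2) * (\<integral>\<^sup>+t. (\<integral>\<^sup>+s. ?q t * ?H s t \<partial>lborel) \<partial>lborel)
      + ennreal (1/2) * (\<integral>\<^sup>+t. (\<integral>\<^sup>+s. ?q s * ?H s t \<partial>lborel) \<partial>lborel)"
    by (simp add: nn_integral_add nn_integral_cmult)
  also have "(\<integral>\<^sup>+t. (\<integral>\<^sup>+s. ?q s * ?H s t \<partial>lborel) \<partial>lborel) = (\<integral>\<^sup>+s. (\<integral>\<^sup>+t. ?q s * ?H s t \<partial>lborel) \<partial>lborel)"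
    by (rule lborel_pair.Fubini') measurable
  also have "(\<integral>\<^sup>+s. (\<integral>\<^sup>+t. ?q s * ?H s t \<partial>lborel) \<partial>lborel) = (\<integral>\<^sup>+s. ?q s \<partial>lborel)"
  proof (rule nn_integral_cong)
    fix s :: 'a
    have "(\<integral>\<^sup>+t. ?H s t \<partial>lborel) = 1"
      using nn_integral_heat_kernel[OF c, of s] heat_kernel_minus[of c "s - t" for t] by simp
    then show "(\<integral>\<^sup>+t. ?q s * ?H s t \<partial>lborel) = ?q s" by (simp add: nn_integral_cmult)
  qed
  also have "(\<integral>\<^sup>+t. (\<integral>\<^sup>+s. ?q t * ?H s t \<partial>lborel) \<partial>lborel) = (\<integral>\<^sup>+t. ?q t \<partial>lborel)"
    by (simp add: nn_integral_cmult nn_integral_heat_kernel[OF c])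
  also have "ennreal (1/2) * (\<integral>\<^sup>+t. ?q t \<partial>lborel) + ennreal (1/2) * (\<integral>\<^sup>+t. ?q t \<partial>lborel) = (\<integral>\<^sup>+t. ?q t \<partial>lborel)"
    by (subst distrib_right[symmetric], subst ennreal_plus[symmetric]) auto
  finally have "ennreal ?I \<le> (\<integral>\<^sup>+t. ?q t \<partial>lborel)" .
  moreover have "(\<integral>\<^sup>+\<omega>. ennreal ((cmod (fourier_integral f \<omega>))\<^sup>2 * gaussian c \<omega>) \<partial>lborel) = ennreal ?I"
    by (rule nn_integral_eq_integral[OF gaussian_regularised_fourier_norm(1)[OF f c]])
      (simp add: gaussian_pos less_imp_le)
  ultimately show ?thesis by simp
qed

text \<open>
  Let the damping factor tend to one and apply Fatou's lemma.  The right-hand side may be infinite,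
  which is convenient when the inequality is integrated over a parameter.
\<close>

lemma fourier_integral_Bessel:
  fixes f :: "'a::euclidean_space \<Rightarrow> complex"
  assumes f: "integrable lborel f"
  shows "(\<integral>\<^sup>+\<omega>. ennreal ((cmod (fourier_integral f \<omega>))\<^sup>2) \<partial>lborel)
    \<le> (\<integral>\<^sup>+t. ennreal ((cmod (f t))\<^sup>2) \<partial>lborel)"
proof -
  have [measurable]: "f \<in> borel_measurable borel"
    using f by auto
  let ?F = "fourier_integral f"
  let ?g = "\<lambda>n \<omega>. ennreal ((cmod (?F \<omega>))\<^sup>2 * gaussian (inverse (real (Suc n))) \<omega>)"
  have "liminf (\<lambda>n. ?g n \<omega>) = ennreal ((cmod (?F \<omega>))\<^sup>2)" for \<omega>
  proof (rule lim_imp_Liminf)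
    have "(\<lambda>n. (cmod (?F \<omega>))\<^sup>2 * exp (- (pi * inverse (real (Suc n)) * (\<omega> \<bullet> \<omega>))))
        \<longlonglongrightarrow> (cmod (?F \<omega>))\<^sup>2 * exp (- (pi * 0 * (\<omega> \<bullet> \<omega>)))"
      by (intro tendsto_intros LIMSEQ_inverse_real_of_nat)
    then show "(\<lambda>n. ?g n \<omega>) \<longlonglongrightarrow> ennreal ((cmod (?F \<omega>))\<^sup>2)"
      by (intro tendsto_ennrealI) (simp add: gaussian_def)
  qed simp
  then have "(\<integral>\<^sup>+\<omega>. ennreal ((cmod (?F \<omega>))\<^sup>2) \<partial>lborel) = (\<integral>\<^sup>+\<omega>. liminf (\<lambda>n. ?g n \<omega>) \<partial>lborel)"
    by simp
  also have "\<dots> \<le> liminf (\<lambda>n. \<integral>\<^sup>+\<omega>. ?g n \<omega> \<partial>lborel)"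
    by (rule nn_integral_liminf) measurable
  also have "\<dots> \<le> liminf (\<lambda>n. \<integral>\<^sup>+t. ennreal ((cmod (f t))\<^sup>2) \<partial>lborel)"
    by (intro Liminf_mono always_eventually allI gaussian_regularised_fourier_norm_le f) simp
  finally show ?thesis by (simp add: Liminf_const)
qed

lemma norm_fourier_integral_le:
  fixes f :: "'a::euclidean_space \<Rightarrow> complex"
  assumes f: "integrable lborel f" "square_integrable f"
  shows "square_integrable (fourier_integral f)"
    and "norm (abs_L2 (fourier_integral f)) \<le> norm (abs_L2 f)"
proof -
  have "fourier_integral f \<in> borel_measurable borel"
    using f by (intro fourier_integral_measurable square_integrable_measurable)
  moreover have "(\<integral>\<^sup>+\<omega>. ennreal ((cmod (fourier_integral f \<omega>))\<^sup>2) \<partial>lborel) \<le> ennreal ((norm (abs_L2 f))\<^sup>2)"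
    using fourier_integral_Bessel[OF f(1)] by (simp only: nn_integral_square_eq_norm[OF f(2)])
  ultimately show "square_integrable (fourier_integral f)"
    "norm (abs_L2 (fourier_integral f)) \<le> norm (abs_L2 f)"
    by (auto intro: norm_abs_L2_le)
qed

section \<open>The Fourier transform of square-integrable functions\<close>

lemma fourier_integral_add:
  assumes "integrable lborel f" "integrable lborel g"
  shows "fourier_integral (\<lambda>t. f t + g t) = (\<lambda>\<omega>. fourier_integral f \<omega> + fourier_integral g \<omega>)"
proof
  fix \<omega>
  show "fourier_integral (\<lambda>t. f t + g t) \<omega> = fourier_integral f \<omega> + fourier_integral g \<omega>"
    unfolding fourier_integral_def distrib_right
    using assms by (intro Bochner_Integration.integral_add integrable_cis_mult) auto
qed

lemma fourier_integral_cmult: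
  "fourier_integral (\<lambda>t. c * f t) = (\<lambda>\<omega>. c * fourier_integral f \<omega>)"
  by (simp add: fourier_integral_def fun_eq_iff mult.assoc)

text \<open>
  The form of the contraction property that lets Cauchy sequences pass through the Fourier
  integral.
\<close>

lemma norm_fourier_integral_diff_le:
  fixes f g :: "'a::euclidean_space \<Rightarrow> complex"
  assumes f: "integrable lborel f" "square_integrable f"
    and g: "integrable lborel g" "square_integrable g"
  shows "norm (abs_L2 (fourier_integral f) - abs_L2 (fourier_integral g)) \<le> norm (abs_L2 f - abs_L2 g)"
proof -
  have eq: "fourier_integral (\<lambda>t. f t - g t) = (\<lambda>\<omega>. fourier_integral f \<omega> - fourier_integral g \<omega>)"
    using fourier_integral_add[OF f(1) integrable_mult_right[OF g(1), of "- 1"]]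
      fourier_integral_cmult[of "- 1" g] by simp
  have "norm (abs_L2 (fourier_integral (\<lambda>t. f t - g t))) \<le> norm (abs_L2 (\<lambda>t. f t - g t))"
    using f g by (intro norm_fourier_integral_le square_integrable_minus) auto
  then show ?thesis
    using f g by (simp add: eq abs_L2_minus norm_fourier_integral_le)
qed

text \<open>
  The value at \<open>g\<close> is the limit of the Fourier integrals of the truncations of \<open>g\<close>.  By the
  contraction property any other sequence in \<open>L\<^sup>1 \<inter> L\<^sup>2\<close> that approximates \<open>g\<close> gives the same limit;
  linearity and agreement with the Fourier integral follow by choosing that sequence well.
\<close>

lemma fourier_extension_exists:
  "\<exists>F :: 'a::euclidean_space L2 \<Rightarrow>\<^sub>L 'a L2. F \<in> bounded_clinear_ops \<and>
     (\<forall>f. integrable lborel f \<and> square_integrable f \<longrightarrow>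
       square_integrable (fourier_integral f) \<and>
       blinfun_apply F (abs_L2 f) = abs_L2 (fourier_integral f))"
proof -
  define tr where "tr n g = truncate n (rep_L2 g)" for n and g :: "'a L2"
  have tr: "integrable lborel (tr n g)" "square_integrable (tr n g)" for n g
    by (simp_all add: tr_def integrable_truncate square_integrable_truncate square_integrable_rep_L2)
  have tr_lim: "(\<lambda>n. abs_L2 (tr n g)) \<longlonglongrightarrow> g" for g
    using abs_L2_truncate_tendsto[OF square_integrable_rep_L2, of g] by (simp add: tr_def abs_rep_L2)
  define \<Phi> where "\<Phi> n g = abs_L2 (fourier_integral (tr n g))" for n g
  have "convergent (\<lambda>n. \<Phi> n g)" for g
  proof -
    have "Cauchy (\<lambda>n. abs_L2 (tr n g))"
      using tr_lim by (rule LIMSEQ_imp_Cauchy)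
    moreover have "dist (\<Phi> m g) (\<Phi> n g) \<le> dist (abs_L2 (tr m g)) (abs_L2 (tr n g))" for m n
      unfolding \<Phi>_def dist_norm by (intro norm_fourier_integral_diff_le tr)
    ultimately have "Cauchy (\<lambda>n. \<Phi> n g)"
      unfolding Cauchy_def by (meson le_less_trans)
    then show ?thesis by (simp add: Cauchy_convergent_iff)
  qed
  then obtain T where T: "\<And>g. (\<lambda>n. \<Phi> n g) \<longlonglongrightarrow> T g"
    unfolding convergent_def by metis
  have T_lim: "(\<lambda>n. abs_L2 (fourier_integral (f n))) \<longlonglongrightarrow> T g"
    if f: "\<And>n. integrable lborel (f n)" "\<And>n. square_integrable (f n)" "(\<lambda>n. abs_L2 (f n)) \<longlonglongrightarrow> g" for f g
  proof -
    have "(\<lambda>n. abs_L2 (f n) - abs_L2 (tr n g)) \<longlonglongrightarrow> g - g"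
      by (intro tendsto_diff f tr_lim)
    then have "(\<lambda>n. norm (abs_L2 (f n) - abs_L2 (tr n g))) \<longlonglongrightarrow> 0"
      by (simp add: tendsto_norm_zero)
    then have "(\<lambda>n. abs_L2 (fourier_integral (f n)) - \<Phi> n g) \<longlonglongrightarrow> 0"
      by (rule Lim_null_comparison[rotated])
        (simp add: \<Phi>_def norm_fourier_integral_diff_le f tr)
    from tendsto_add[OF this T[of g]] show ?thesis by simp
  qed
  have T_add: "T (g + h) = T g + T h" for g h
  proof (rule LIMSEQ_unique)
    let ?f = "\<lambda>n t. tr n g t + tr n h t"
    show "(\<lambda>n. abs_L2 (fourier_integral (?f n))) \<longlonglongrightarrow> T (g + h)"
    proof (rule T_lim)
      show "(\<lambda>n. abs_L2 (?f n)) \<longlonglongrightarrow> g + h"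
        using tendsto_add[OF tr_lim tr_lim, of g h] by (simp add: abs_L2_add tr)
    qed (auto intro: tr square_integrable_add)
    show "(\<lambda>n. abs_L2 (fourier_integral (?f n))) \<longlonglongrightarrow> T g + T h"
      using tendsto_add[OF T T, of g h]
      by (simp add: \<Phi>_def fourier_integral_add tr abs_L2_add norm_fourier_integral_le)
  qed
  have T_norm: "norm (T g) \<le> norm g" for g
  proof (rule LIMSEQ_le)
    show "(\<lambda>n. norm (\<Phi> n g)) \<longlonglongrightarrow> norm (T g)" by (intro tendsto_norm T)
    show "(\<lambda>n. norm (abs_L2 (tr n g))) \<longlonglongrightarrow> norm g" by (intro tendsto_norm tr_lim)
    show "\<exists>N. \<forall>n\<ge>N. norm (\<Phi> n g) \<le> norm (abs_L2 (tr n g))"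
      by (simp add: \<Phi>_def norm_fourier_integral_le tr)
  qed
  have cscale_lim: "(\<lambda>n. cscale c (X n)) \<longlonglongrightarrow> cscale c x" if "X \<longlonglongrightarrow> x" for c X and x :: "'a L2"
  proof -
    have "cscale c y - cscale c z = cscale c (y - z)" for y z :: "'a L2"
      by (rule L2_eqI_cinner) (simp add: cinner_minus_left cinner_cscale_left algebra_simps)
    then have "(\<lambda>n. norm (cscale c (X n) - cscale c x)) = (\<lambda>n. cmod c * norm (X n - x))"
      by (simp add: norm_cscale)
    moreover have "(\<lambda>n. cmod c * norm (X n - x)) \<longlonglongrightarrow> cmod c * 0"
      using that by (intro tendsto_mult tendsto_const) (simp add: LIM_zero tendsto_norm_zero)
    ultimately have "(\<lambda>n. norm (cscale c (X n) - cscale c x)) \<longlonglongrightarrow> 0"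
      by simp
    then show ?thesis
      by (rule LIM_zero_cancel[OF tendsto_norm_zero_cancel])
  qed
  have T_cscale: "T (cscale c g) = cscale c (T g)" for c g
  proof (rule LIMSEQ_unique)
    let ?f = "\<lambda>n t. c * tr n g t"
    show "(\<lambda>n. abs_L2 (fourier_integral (?f n))) \<longlonglongrightarrow> T (cscale c g)"
    proof (rule T_lim)
      show "(\<lambda>n. abs_L2 (?f n)) \<longlonglongrightarrow> cscale c g"
        using cscale_lim[OF tr_lim, of c g] by (simp add: cscale_abs_L2 tr)
    qed (auto intro: tr square_integrable_cmult)
    show "(\<lambda>n. abs_L2 (fourier_integral (?f n))) \<longlonglongrightarrow> cscale c (T g)"
      using cscale_lim[OF T, of c g]
      by (simp add: \<Phi>_def fourier_integral_cmult tr cscale_abs_L2 norm_fourier_integral_le)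
  qed
  have "bounded_linear T"
    by (rule bounded_linear_intro[of _ 1]) (simp_all add: T_add scaleR_eq_cscale T_cscale T_norm)
  then have app: "blinfun_apply (Blinfun T) = T"
    by (rule bounded_linear_Blinfun_apply)
  have "T (abs_L2 f) = abs_L2 (fourier_integral f)" if "integrable lborel f" "square_integrable f" for f
    using T_lim[of "\<lambda>_. f" "abs_L2 f"] that by (simp add: LIMSEQ_const_iff)
  then show ?thesis
    by (intro exI[of _ "Blinfun T"])
      (simp add: app bounded_clinear_ops_def T_cscale norm_fourier_integral_le)
qed

lemma fourier_unique_extension:
  fixes F G :: "'a::euclidean_space L2 \<Rightarrow>\<^sub>L 'a L2"
  assumes eq: "\<And>f. integrable lborel f \<Longrightarrow> square_integrable f \<Longrightarrow>
      blinfun_apply F (abs_L2 f) = blinfun_apply G (abs_L2 f)"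
  shows "F = G"
proof (rule blinfun_eqI)
  fix g :: "'a L2"
  let ?X = "\<lambda>n. abs_L2 (truncate n (rep_L2 g))"
  have X: "?X \<longlonglongrightarrow> g"
    using abs_L2_truncate_tendsto[OF square_integrable_rep_L2, of g] by (simp add: abs_rep_L2)
  have "(\<lambda>n. blinfun_apply F (?X n)) \<longlonglongrightarrow> blinfun_apply F g"
    by (intro tendsto_intros X)
  moreover have "(\<lambda>n. blinfun_apply F (?X n)) \<longlonglongrightarrow> blinfun_apply G g"
    by (subst eq) (auto intro!: tendsto_intros X integrable_truncate square_integrable_truncate square_integrable_rep_L2)
  ultimately show "blinfun_apply F g = blinfun_apply G g"
    by (rule LIMSEQ_unique)
qed

lemma fourier_properties:
  shows "fourier \<in> (bounded_clinear_ops :: ('a::euclidean_space L2 \<Rightarrow>\<^sub>L 'a L2) set)"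
    and "\<And>f :: 'a \<Rightarrow> complex. integrable lborel f \<Longrightarrow> square_integrable f \<Longrightarrow>
      blinfun_apply fourier (abs_L2 f) = abs_L2 (fourier_integral f)"
proof -
  let ?P = "\<lambda>F :: 'a L2 \<Rightarrow>\<^sub>L 'a L2. F \<in> bounded_clinear_ops \<and> (\<forall>f. integrable lborel f \<and> square_integrable f \<longrightarrow>
     square_integrable (fourier_integral f) \<and>
     blinfun_apply F (abs_L2 f) = abs_L2 (fourier_integral f))"
  obtain F where F: "?P F" using fourier_extension_exists by blast
  have "?P fourier"
    unfolding fourier_def
  proof (rule theI[of ?P, OF F])
    show "G = F" if "?P G" for G
      using that F by (intro fourier_unique_extension) auto
  qed
  then show "fourier \<in> (bounded_clinear_ops :: ('a L2 \<Rightarrow>\<^sub>L 'a L2) set)"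
    and "\<And>f :: 'a \<Rightarrow> complex. integrable lborel f \<Longrightarrow> square_integrable f \<Longrightarrow>
      blinfun_apply fourier (abs_L2 f) = abs_L2 (fourier_integral f)"
    by auto
qed

section \<open>The short-time Fourier transform\<close>

lemma nn_integral_lborel_reflect:
  fixes c :: "'a::euclidean_space"
  assumes [measurable]: "f \<in> borel_measurable borel"
  shows "(\<integral>\<^sup>+t. f (c - t) \<partial>lborel) = (\<integral>\<^sup>+t. f t \<partial>lborel)"
proof -
  have "lborel = distr lborel borel (\<lambda>x::'a. c - x)"
    using lborel_affine[of "- 1" c] by (simp add: density_1)
  then have "(\<integral>\<^sup>+t. f t \<partial>lborel) = (\<integral>\<^sup>+t. f t \<partial>distr lborel borel (\<lambda>x. c - x))"
    by simp
  also have "\<dots> = (\<integral>\<^sup>+t. f (c - t) \<partial>lborel)"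
    by (rule nn_integral_distr) auto
  finally show ?thesis ..
qed

lemma square_integrable_tf_shift:
  assumes "square_integrable f"
  shows "square_integrable (\<lambda>t. cis (2 * pi * (\<xi> \<bullet> t)) * f (t - x))"
proof (rule square_integrable_dominated[OF _ square_integrable_translate[OF assms, of x]])
  have [measurable]: "f \<in> borel_measurable borel"
    using assms by (rule square_integrable_measurable)
  show "(\<lambda>t. cis (2 * pi * (\<xi> \<bullet> t)) * f (t - x)) \<in> borel_measurable borel"
    by measurable
qed (simp add: norm_mult)

lemma tf_shift_abs_L2:
  "square_integrable f \<Longrightarrow>
    tf_shift (x, \<xi>) (abs_L2 f) = abs_L2 (\<lambda>t. cis (2 * pi * (\<xi> \<bullet> t)) * f (t - x))"
  using tf_shift.abs_eq[OF L2_eq_refl, of f "(x, \<xi>)"] by simp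

lemma norm_tf_shift: "norm (tf_shift z f) = norm f"
proof -
  obtain x \<xi> where z: "z = (x, \<xi>)" by fastforce
  obtain g where g: "square_integrable g" "f = abs_L2 g" by (rule abs_L2_exhaust)
  have [measurable]: "g \<in> borel_measurable borel"
    using g by (simp add: square_integrable_measurable)
  have "ennreal ((norm (tf_shift z f))\<^sup>2) = (\<integral>\<^sup>+t. ennreal ((cmod (g (- x + t)))\<^sup>2) \<partial>lborel)"
    by (simp add: z g tf_shift_abs_L2 nn_integral_square_eq_norm[symmetric] square_integrable_tf_shift norm_mult)
  also have "\<dots> = ennreal ((norm f)\<^sup>2)"
    by (subst nn_integral_lborel_translate[of "\<lambda>t. ennreal ((cmod (g t))\<^sup>2)"])
      (simp_all add: g nn_integral_square_eq_norm)
  finally show ?thesis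
    by (simp add: power2_eq_iff_nonneg)
qed

text \<open>
  For fixed time \<open>x\<close> the short-time Fourier transform is an ordinary Fourier integral, so that
  facts about the latter apply in the frequency variable.
\<close>

lemma stft_abs_L2:
  assumes "square_integrable f" "square_integrable g"
  shows "stft (abs_L2 g) (abs_L2 f) (x, \<xi>) = fourier_integral (\<lambda>t. f t * cnj (g (t - x))) \<xi>"
  using assms
  by (simp add: stft_def tf_shift_abs_L2 cinner_abs_L2 square_integrable_tf_shift fourier_integral_def)
    (simp add: cis_cnj mult_ac)

lemma stft_measurable [measurable]:
  fixes f g :: "'a::euclidean_space L2"
  shows "stft g f \<in> borel_measurable borel"
proof -
  have [measurable]: "rep_L2 f \<in> borel_measurable borel" "rep_L2 g \<in> borel_measurable borel"
    by (intro square_integrable_measurable square_integrable_rep_L2)+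
  have "stft g f = (\<lambda>z. \<integral>t. rep_L2 f t * cnj (rep_L2 g (t - fst z)) * cis (- (2 * pi * (snd z \<bullet> t))) \<partial>lborel)"
    using stft_abs_L2[OF square_integrable_rep_L2 square_integrable_rep_L2, of g f]
    by (auto simp: fun_eq_iff abs_rep_L2 fourier_integral_def)
  moreover have "\<dots> \<in> borel_measurable (borel \<Otimes>\<^sub>M borel)"
    by (rule lborel.borel_measurable_lebesgue_integral) measurable
  ultimately show ?thesis by (simp add: borel_prod)
qed

text \<open>
  Apply the Bessel inequality in the frequency variable for each \<open>x\<close>, then exchange the order of
  integration: the remaining integral over \<open>x\<close> is \<open>\<parallel>g\<parallel>\<^sup>2\<close> for every \<open>t\<close>.
\<close>

lemma nn_integral_stft_le:
  fixes f g :: "'a::euclidean_space L2"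
  shows "(\<integral>\<^sup>+z. ennreal ((cmod (stft g f z))\<^sup>2) \<partial>lborel) \<le> ennreal ((norm f * norm g)\<^sup>2)"
proof -
  obtain u where u: "square_integrable u" "f = abs_L2 u" by (rule abs_L2_exhaust)
  obtain v where v: "square_integrable v" "g = abs_L2 v" by (rule abs_L2_exhaust)
  have [measurable]: "u \<in> borel_measurable borel" "v \<in> borel_measurable borel"
    using u v by (simp_all add: square_integrable_measurable)
  have int: "integrable lborel (\<lambda>t. u t * cnj (v (t - x)))" for x
    by (intro integrable_mult_cnj u square_integrable_translate v)
  have "(\<integral>\<^sup>+z. ennreal ((cmod (stft g f z))\<^sup>2) \<partial>lborel)
      = (\<integral>\<^sup>+x. (\<integral>\<^sup>+\<xi>. ennreal ((cmod (stft g f (x, \<xi>)))\<^sup>2) \<partial>lborel) \<partial>lborel)"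
    by (subst lborel_prod[symmetric], subst lborel.nn_integral_fst[symmetric]) (auto simp: lborel_prod)
  also have "\<dots> = (\<integral>\<^sup>+x. (\<integral>\<^sup>+\<xi>. ennreal ((cmod (fourier_integral (\<lambda>t. u t * cnj (v (t - x))) \<xi>))\<^sup>2) \<partial>lborel) \<partial>lborel)"
    using u v by (simp add: stft_abs_L2)
  also have "\<dots> \<le> (\<integral>\<^sup>+x. (\<integral>\<^sup>+t. ennreal ((cmod (u t * cnj (v (t - x))))\<^sup>2) \<partial>lborel) \<partial>lborel)"
    by (intro nn_integral_mono fourier_integral_Bessel int)
  also have "\<dots> = (\<integral>\<^sup>+t. (\<integral>\<^sup>+x. ennreal ((cmod (u t * cnj (v (t - x))))\<^sup>2) \<partial>lborel) \<partial>lborel)"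
    by (rule lborel_pair.Fubini') measurable
  also have "\<dots> = (\<integral>\<^sup>+t. ennreal ((cmod (u t))\<^sup>2) * ennreal ((norm g)\<^sup>2) \<partial>lborel)"
  proof (rule nn_integral_cong)
    fix t
    have "(\<integral>\<^sup>+x. ennreal ((cmod (v (t - x)))\<^sup>2) \<partial>lborel) = ennreal ((norm g)\<^sup>2)"
      by (subst nn_integral_lborel_reflect[of "\<lambda>t. ennreal ((cmod (v t))\<^sup>2)"])
        (simp_all add: v nn_integral_square_eq_norm)
    then show "(\<integral>\<^sup>+x. ennreal ((cmod (u t * cnj (v (t - x))))\<^sup>2) \<partial>lborel)
        = ennreal ((cmod (u t))\<^sup>2) * ennreal ((norm g)\<^sup>2)"
      by (simp add: norm_mult power_mult_distrib ennreal_mult nn_integral_cmult)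
  qed
  also have "\<dots> = ennreal ((norm f * norm g)\<^sup>2)"
    by (simp add: nn_integral_multc nn_integral_square_eq_norm u ennreal_mult power_mult_distrib)
  finally show ?thesis .
qed

lemma stft_square_integrable: "square_integrable (stft g f)"
  and norm_stft_le: "norm (abs_L2 (stft g f)) \<le> norm f * norm g"
  using norm_abs_L2_le[OF stft_measurable nn_integral_stft_le] by auto

lemma stft_add: "stft g (f + h) z = stft g f z + stft g h z"
  by (simp add: stft_def cinner_add_left)

lemma stft_cscale: "stft g (cscale c f) z = c * stft g f z"
  by (simp add: stft_def cinner_cscale_left)

section \<open>Localization operators\<close>

text \<open>
  Riesz representation of \<open>g \<mapsto> Re (B f g)\<close> gives the value at \<open>f\<close>; replacing \<open>g\<close> by \<open>\<i> g\<close> recovers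
  the imaginary part of \<open>B\<close>.  Every remaining property of the operator is read off from \<open>B\<close> by
  testing against all \<open>g\<close>.
\<close>

lemma bounded_sesquilinear_form_operator:
  fixes B :: "'a::euclidean_space L2 \<Rightarrow> 'a L2 \<Rightarrow> complex"
  assumes add1: "\<And>f f' g. B (f + f') g = B f g + B f' g"
    and scale1: "\<And>c f g. B (cscale c f) g = c * B f g"
    and add2: "\<And>f g g'. B f (g + g') = B f g + B f g'"
    and scale2: "\<And>c f g. B f (cscale c g) = cnj c * B f g"
    and bound: "\<And>f g. cmod (B f g) \<le> K * norm f * norm g"
  shows "\<exists>!A. A \<in> bounded_clinear_ops \<and> (\<forall>f g. cinner (blinfun_apply A f) g = B f g)"
proof -
  have "\<exists>y. \<forall>g. cinner y g = B f g" for f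
  proof -
    have "bounded_linear (\<lambda>g. Re (B f g))"
    proof (rule bounded_linear_intro)
      show "norm (Re (B f g)) \<le> norm g * (K * norm f)" for g
        using abs_Re_le_cmod[of "B f g"] bound[of f g] by (simp add: mult_ac)
    qed (simp_all add: add2 scaleR_eq_cscale scale2)
    then obtain y where y: "\<And>g. Re (B f g) = g \<bullet> y"
      using Riesz_representation by blast
    have Re: "Re (cinner y g) = Re (B f g)" for g
      using y by (simp add: inner_commute[of g] inner_L2_def[of y])
    have "cinner y g = B f g" for g
      using Re[of g] Re[of "cscale \<i> g"] by (simp add: cinner_cscale_right scale2 complex_eq_iff)
    then show ?thesis by blast
  qed
  then obtain T where T: "\<And>f g. cinner (T f) g = B f g" by metis
  have T_cscale: "T (cscale c f) = cscale c (T f)" for c f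
    by (rule L2_eqI_cinner) (simp add: T scale1 cinner_cscale_left)
  have "bounded_linear T"
  proof (rule bounded_linear_intro)
    show "T (f + g) = T f + T g" for f g
      by (rule L2_eqI_cinner) (simp add: T add1 cinner_add_left)
    show "T (r *\<^sub>R f) = r *\<^sub>R T f" for r f
      by (simp add: scaleR_eq_cscale T_cscale)
    show "norm (T f) \<le> norm f * K" for f
    proof (cases "T f = 0")
      case True
      have "0 \<le> norm f * K"
      proof (cases "f = 0")
        case False
        have "0 \<le> K * norm f * norm f" using bound[of f f] norm_ge_zero order_trans by blast
        then have "0 \<le> K * norm f" using False by (simp add: zero_le_mult_iff)
        then show ?thesis by (simp add: mult.commute)
      qed simp
      then show ?thesis using True by simp
    next
      case False
      have "(norm (T f))\<^sup>2 = cmod (cinner (T f) (T f))"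
        by (simp add: cinner_self norm_power)
      also have "\<dots> \<le> K * norm f * norm (T f)"
        unfolding T by (rule bound)
      finally show ?thesis
        using False by (simp add: power2_eq_square mult.commute)
    qed
  qed
  then have app: "blinfun_apply (Blinfun T) = T"
    by (rule bounded_linear_Blinfun_apply)
  show ?thesis
  proof (rule ex1I[of _ "Blinfun T"])
    show "Blinfun T \<in> bounded_clinear_ops \<and> (\<forall>f g. cinner (blinfun_apply (Blinfun T) f) g = B f g)"
      by (simp add: bounded_clinear_ops_def app T_cscale T)
    show "A = Blinfun T" if "A \<in> bounded_clinear_ops \<and> (\<forall>f g. cinner (blinfun_apply A f) g = B f g)" for A
      using that by (intro blinfun_eqI L2_eqI_cinner) (simp add: app T)
  qed
qed

lemma Linfty_bound:
  assumes "a \<in> Linfty"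
  obtains C where "0 \<le> C" "AE z in lborel. cmod (a z) \<le> C" "a \<in> borel_measurable borel"
proof -
  obtain C where C: "AE z in lborel. cmod (a z) \<le> C" and m: "a \<in> borel_measurable borel"
    using assms by (auto simp: Linfty_def)
  from C have "AE z in lborel. cmod (a z) \<le> max 0 C"
    by eventually_elim auto
  with m show ?thesis using that[of "max 0 C"] by auto
qed

lemma Linfty_mult_L2:
  assumes m: "a \<in> borel_measurable borel" and C: "AE z in lborel. cmod (a z) \<le> C" "0 \<le> C"
    and u: "square_integrable u"
  shows "square_integrable (\<lambda>z. a z * u z)" "norm (abs_L2 (\<lambda>z. a z * u z)) \<le> C * norm (abs_L2 u)"
proof -
  have [measurable]: "u \<in> borel_measurable borel" "a \<in> borel_measurable borel"
    using u m by (auto intro: square_integrable_measurable)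
  have "AE z in lborel. ennreal ((cmod (a z * u z))\<^sup>2) \<le> ennreal (C\<^sup>2) * ennreal ((cmod (u z))\<^sup>2)"
    using C(1)
  proof eventually_elim
    case (elim z)
    then have "(cmod (a z))\<^sup>2 * (cmod (u z))\<^sup>2 \<le> C\<^sup>2 * (cmod (u z))\<^sup>2"
      by (intro mult_right_mono power_mono) auto
    then show ?case
      by (simp add: norm_mult power_mult_distrib ennreal_mult[symmetric] ennreal_leI)
  qed
  then have "(\<integral>\<^sup>+z. ennreal ((cmod (a z * u z))\<^sup>2) \<partial>lborel)
      \<le> (\<integral>\<^sup>+z. ennreal (C\<^sup>2) * ennreal ((cmod (u z))\<^sup>2) \<partial>lborel)"
    by (rule nn_integral_mono_AE)
  also have "\<dots> = ennreal ((C * norm (abs_L2 u))\<^sup>2)"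
    by (simp add: nn_integral_cmult nn_integral_square_eq_norm u ennreal_mult power_mult_distrib)
  finally have *: "(\<integral>\<^sup>+z. ennreal ((cmod (a z * u z))\<^sup>2) \<partial>lborel) \<le> ennreal ((C * norm (abs_L2 u))\<^sup>2)" .
  show "square_integrable (\<lambda>z. a z * u z)" "norm (abs_L2 (\<lambda>z. a z * u z)) \<le> C * norm (abs_L2 u)"
    using norm_abs_L2_le[OF _ *] C(2) by auto
qed

text \<open>
  The integral is the inner product of \<open>a * V f\<close> and \<open>V g\<close> in \<open>L\<^sup>2\<close> of the plane, hence a bounded
  sesquilinear form, and the definite description picks the operator that it determines.
\<close>

lemma cinner_localization_op:
  assumes a: "a \<in> Linfty"
  shows "cinner (blinfun_apply (localization_op \<phi>1 \<phi>2 a) f) g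
    = (\<integral>z. a z * stft \<phi>1 f z * cnj (stft \<phi>2 g z) \<partial>lborel)"
proof -
  obtain C where C: "0 \<le> C" "AE z in lborel. cmod (a z) \<le> C" and m: "a \<in> borel_measurable borel"
    using a by (rule Linfty_bound)
  let ?B = "\<lambda>f g. \<integral>z. a z * stft \<phi>1 f z * cnj (stft \<phi>2 g z) \<partial>lborel"
  have aV: "square_integrable (\<lambda>z. a z * stft \<phi>1 f z)"
      "norm (abs_L2 (\<lambda>z. a z * stft \<phi>1 f z)) \<le> C * norm (abs_L2 (stft \<phi>1 f))" for f
    using Linfty_mult_L2[OF m C(2,1) stft_square_integrable] by auto
  have int: "integrable lborel (\<lambda>z. a z * stft \<phi>1 f z * cnj (stft \<phi>2 g z))" for f g
    by (rule integrable_mult_cnj[OF aV(1) stft_square_integrable])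
  have "\<exists>!A. A \<in> bounded_clinear_ops \<and> (\<forall>f g. cinner (blinfun_apply A f) g = ?B f g)"
  proof (rule bounded_sesquilinear_form_operator)
    show "?B (f + f') g = ?B f g + ?B f' g" for f f' g
      using Bochner_Integration.integral_add[OF int[of f g] int[of f' g]]
      by (simp add: stft_add algebra_simps)
    show "?B f (g + g') = ?B f g + ?B f g'" for f g g'
      using Bochner_Integration.integral_add[OF int[of f g] int[of f g']]
      by (simp add: stft_add algebra_simps)
    show "?B (cscale c f) g = c * ?B f g" for c f g
      unfolding stft_cscale integral_mult_right_zero[symmetric] by (simp add: mult_ac)
    show "?B f (cscale c g) = cnj c * ?B f g" for c f g
      unfolding stft_cscale integral_mult_right_zero[symmetric] by (simp add: mult_ac)
    show "cmod (?B f g) \<le> (C * norm \<phi>1 * norm \<phi>2) * norm f * norm g" for f g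
    proof -
      have "cmod (?B f g) = cmod (cinner (abs_L2 (\<lambda>z. a z * stft \<phi>1 f z)) (abs_L2 (stft \<phi>2 g)))"
        by (simp add: cinner_abs_L2 aV stft_square_integrable)
      also have "\<dots> \<le> norm (abs_L2 (\<lambda>z. a z * stft \<phi>1 f z)) * norm (abs_L2 (stft \<phi>2 g))"
        by (rule cmod_cinner_le)
      also have "\<dots> \<le> (C * (norm f * norm \<phi>1)) * (norm g * norm \<phi>2)"
        using C(1) by (intro mult_mono order_trans[OF aV(2)] mult_left_mono norm_stft_le) auto
      finally show ?thesis by (simp add: mult_ac)
    qed
  qed
  from theI'[OF this] show ?thesis
    by (simp add: localization_op_def)
qed

section \<open>Time-frequency covariance and decay of correlations\<close>

lemma fourier_integral_translate:
  fixes k :: "'a::euclidean_space \<Rightarrow> complex"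
  assumes [measurable]: "k \<in> borel_measurable borel"
  shows "fourier_integral (\<lambda>t. k (t - y)) \<omega> = cis (- (2 * pi * (\<omega> \<bullet> y))) * fourier_integral k \<omega>"
proof -
  have "fourier_integral (\<lambda>t. k (t - y)) \<omega> = (\<integral>t. k (y + t - y) * cis (- (2 * pi * (\<omega> \<bullet> (y + t)))) \<partial>lborel)"
    unfolding fourier_integral_def by (rule integral_lborel_translate[symmetric]) measurable
  also have "\<dots> = (\<integral>t. cis (- (2 * pi * (\<omega> \<bullet> y))) * (k t * cis (- (2 * pi * (\<omega> \<bullet> t)))) \<partial>lborel)"
    by (intro Bochner_Integration.integral_cong refl)
      (simp add: inner_add_right distrib_left cis_mult[symmetric] cis_divide[symmetric]
        cis_cnj[symmetric] mult_ac divide_inverse)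
  finally show ?thesis
    by (simp add: fourier_integral_def)
qed

text \<open>
  A time-frequency shift of \<open>f\<close> shifts \<open>V f\<close> and multiplies it by a phase; modulations and
  translations of the integrand act on its Fourier integral by translations and phases.
\<close>

lemma cmod_stft_tf_shift:
  "cmod (stft g (tf_shift w f) z) = cmod (stft g f (z - w))"
proof -
  obtain u where u: "square_integrable u" "f = abs_L2 u" by (rule abs_L2_exhaust)
  obtain v where v: "square_integrable v" "g = abs_L2 v" by (rule abs_L2_exhaust)
  have [measurable]: "u \<in> borel_measurable borel" "v \<in> borel_measurable borel"
    using u v by (simp_all add: square_integrable_measurable)
  obtain x \<xi> y \<eta> where z: "z = (x, \<xi>)" "w = (y, \<eta>)" by fastforce
  define k where "k t = u t * cnj (v (t - (x - y)))" for t
  have k: "k \<in> borel_measurable borel"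
    unfolding k_def by measurable
  have "stft g (tf_shift w f) z = fourier_integral (\<lambda>t. cis (2 * pi * (\<eta> \<bullet> t)) * k (t - y)) \<xi>"
    unfolding z u v k_def
    by (simp only: tf_shift_abs_L2[OF u(1)] stft_abs_L2[OF square_integrable_tf_shift[OF u(1)] v(1)])
      (simp add: mult.assoc)
  also have "\<dots> = cis (- (2 * pi * ((\<xi> - \<eta>) \<bullet> y))) * fourier_integral k (\<xi> - \<eta>)"
    by (simp only: fourier_integral_modulation fourier_integral_translate[OF k])
  also have "fourier_integral k (\<xi> - \<eta>) = stft g f (z - w)"
    unfolding z u v k_def by (simp add: stft_abs_L2 u v)
  finally show ?thesis
    by (simp add: norm_mult)
qed

lemma tf_shift_minus: "tf_shift z (f - g) = tf_shift z f - tf_shift z g"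
proof -
  obtain u where u: "square_integrable u" "f = abs_L2 u" by (rule abs_L2_exhaust)
  obtain v where v: "square_integrable v" "g = abs_L2 v" by (rule abs_L2_exhaust)
  obtain x \<xi> where z: "z = (x, \<xi>)" by fastforce
  show ?thesis
    by (simp add: u v z abs_L2_minus tf_shift_abs_L2 square_integrable_tf_shift square_integrable_minus
        right_diff_distrib)
qed

lemma cinner_translate_truncated_eq_0:
  assumes u: "square_integrable u" and v: "square_integrable v" and x: "norm x > 2 * real n"
  shows "cinner (tf_shift (x, 0) (abs_L2 (truncate n u))) (abs_L2 (truncate n v)) = 0"
proof -
  have zero: "truncate n u (t - x) * cnj (truncate n v t) = 0" for t
    using norm_triangle_ineq4[of t "t - x"] x by (auto simp: truncate_def)
  have "cinner (tf_shift (x, 0) (abs_L2 (truncate n u))) (abs_L2 (truncate n v))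
      = (\<integral>t. truncate n u (t - x) * cnj (truncate n v t) \<partial>lborel)"
    by (simp add: tf_shift_abs_L2 cinner_abs_L2 square_integrable_truncate u v
        square_integrable_tf_shift square_integrable_translate)
  then show ?thesis by (simp only: zero integral_zero)
qed

text \<open>
  Truncations of \<open>f\<close> and \<open>g\<close> have disjoint supports once one of them is moved far enough, and the
  truncation errors are controlled uniformly in \<open>x\<close> because translations are isometric.
\<close>

lemma cinner_translate_decay:
  fixes f g :: "'b::euclidean_space L2"
  assumes "e > 0"
  shows "\<exists>R. \<forall>x. norm x > R \<longrightarrow> cmod (cinner (tf_shift (x, 0) f) g) < e"
proof -
  obtain u where u: "square_integrable u" "f = abs_L2 u" by (rule abs_L2_exhaust)
  obtain v where v: "square_integrable v" "g = abs_L2 v" by (rule abs_L2_exhaust)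
  let ?f = "\<lambda>n. abs_L2 (truncate n u)" and ?g = "\<lambda>n. abs_L2 (truncate n v)"
  have "(\<lambda>n. norm f * norm (g - ?g n) + norm (f - ?f n) * norm (?g n))
      \<longlonglongrightarrow> norm f * norm (g - g) + norm (f - f) * norm g"
    using abs_L2_truncate_tendsto[OF u(1)] abs_L2_truncate_tendsto[OF v(1)]
    by (intro tendsto_intros) (simp_all add: u v)
  then have "eventually (\<lambda>n. norm f * norm (g - ?g n) + norm (f - ?f n) * norm (?g n) < e) sequentially"
    by (rule order_tendstoD) (use assms in simp)
  then obtain n where n: "norm f * norm (g - ?g n) + norm (f - ?f n) * norm (?g n) < e"
    by (auto simp: eventually_sequentially)
  have "cmod (cinner (tf_shift (x, 0) f) g) < e" if x: "norm x > 2 * real n" for x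
  proof -
    let ?T = "tf_shift (x, 0)"
    have "cinner (?T f) g = cinner (?T f) (g - ?g n) + cinner (?T (f - ?f n)) (?g n) + cinner (?T (?f n)) (?g n)"
      by (simp add: cinner_minus_right cinner_minus_left tf_shift_minus)
    also have "\<dots> = cinner (?T f) (g - ?g n) + cinner (?T (f - ?f n)) (?g n)"
      using cinner_translate_truncated_eq_0[OF u(1) v(1) x] by simp
    also have "cmod \<dots> \<le> norm (?T f) * norm (g - ?g n) + norm (?T (f - ?f n)) * norm (?g n)"
      by (intro norm_triangle_le add_mono cmod_cinner_le)
    also have "\<dots> < e" using n by (simp only: norm_tf_shift)
    finally show ?thesis .
  qed
  then show ?thesis by blast
qed

text \<open>
  A localization operator almost annihilates the interaction of wave packets sitting far apart in
  the time-frequency plane: the matrix coefficient is dominated by \<open>\<parallel>a\<parallel>\<^sub>\<infinity>\<close> times the correlation of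
  translates of \<open>\<bar>V f\<bar>\<close> and \<open>\<bar>V g\<bar>\<close>, which are functions in \<open>L\<^sup>2\<close> of the plane.
\<close>

lemma localization_op_off_diagonal_bound:
  fixes \<phi>1 \<phi>2 f g :: "'a::euclidean_space L2"
  assumes a: "a \<in> Linfty" and e: "e > 0"
  shows "\<exists>R. \<forall>w w'. norm (w - w') > R \<longrightarrow>
    cmod (cinner (blinfun_apply (localization_op \<phi>1 \<phi>2 a) (tf_shift w f)) (tf_shift w' g)) < e"
proof -
  obtain C where C: "0 \<le> C" "AE z in lborel. cmod (a z) \<le> C" and m: "a \<in> borel_measurable borel"
    using a by (rule Linfty_bound)
  define P where "P z = complex_of_real (cmod (stft \<phi>1 f z))" for z
  define Q where "Q z = complex_of_real (cmod (stft \<phi>2 g z))" for z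
  have P: "square_integrable P"
    unfolding P_def by (rule square_integrable_dominated[OF _ stft_square_integrable[of \<phi>1 f]]) auto
  have Q: "square_integrable Q"
    unfolding Q_def by (rule square_integrable_dominated[OF _ stft_square_integrable[of \<phi>2 g]]) auto
  have [measurable]: "P \<in> borel_measurable borel" "Q \<in> borel_measurable borel"
    using P Q by (simp_all add: square_integrable_measurable)
  (* C + 1 instead of C, since C may vanish. *)
  obtain R where R: "\<And>x. norm x > R \<Longrightarrow> cmod (cinner (tf_shift (x, 0) (abs_L2 P)) (abs_L2 Q)) < e / (C + 1)"
    using cinner_translate_decay[of "e / (C + 1)" "abs_L2 P" "abs_L2 Q"] e C(1) by auto
  have "cmod (cinner (blinfun_apply (localization_op \<phi>1 \<phi>2 a) (tf_shift w f)) (tf_shift w' g)) < e"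
    if w: "norm (w - w') > R" for w w'
  proof -
    let ?U = "stft \<phi>1 (tf_shift w f)" and ?W = "stft \<phi>2 (tf_shift w' g)"
    have PQ: "complex_of_real (cmod (?U z) * cmod (?W z)) = P (z - w) * cnj (Q (z - w'))" for z
      by (simp add: P_def Q_def cmod_stft_tf_shift)
    have int: "integrable lborel (\<lambda>z. cmod (?U z) * cmod (?W z))"
      unfolding complex_of_real_integrable_eq[symmetric] PQ
      by (intro integrable_mult_cnj square_integrable_translate P Q)
    have "complex_of_real (\<integral>z. cmod (?U z) * cmod (?W z) \<partial>lborel) = (\<integral>z. P (z - w) * cnj (Q (z - w')) \<partial>lborel)"
      unfolding integral_complex_of_real[symmetric] PQ ..
    also have "\<dots> = (\<integral>z. P (w' + z - w) * cnj (Q (w' + z - w')) \<partial>lborel)"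
      by (rule integral_lborel_translate[symmetric]) measurable
    also have "\<dots> = (\<integral>z. P (z - (w - w')) * cnj (Q z) \<partial>lborel)"
      by (simp add: algebra_simps)
    also have "\<dots> = cinner (tf_shift (w - w', 0) (abs_L2 P)) (abs_L2 Q)"
      by (simp add: tf_shift_abs_L2 cinner_abs_L2 P Q square_integrable_tf_shift
          square_integrable_translate)
    finally have "cmod (complex_of_real (\<integral>z. cmod (?U z) * cmod (?W z) \<partial>lborel)) < e / (C + 1)"
      using R[OF w] by simp
    then have small: "(\<integral>z. cmod (?U z) * cmod (?W z) \<partial>lborel) < e / (C + 1)"
      by simp
    have "cmod (cinner (blinfun_apply (localization_op \<phi>1 \<phi>2 a) (tf_shift w f)) (tf_shift w' g))
        \<le> (\<integral>z. cmod (a z * ?U z * cnj (?W z)) \<partial>lborel)"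
      unfolding cinner_localization_op[OF a] by (rule integral_norm_bound)
    also have "\<dots> \<le> (\<integral>z. C * (cmod (?U z) * cmod (?W z)) \<partial>lborel)"
    proof (rule integral_mono_AE')
      show "AE z in lborel. cmod (a z * ?U z * cnj (?W z)) \<le> C * (cmod (?U z) * cmod (?W z))"
        using C(2) by eventually_elim (simp add: norm_mult mult.assoc mult_right_mono)
    qed (use int C(1) in auto)
    also have "\<dots> = C * (\<integral>z. cmod (?U z) * cmod (?W z) \<partial>lborel)"
      by simp
    also have "\<dots> \<le> C * (e / (C + 1))"
      using small C(1) by (intro mult_left_mono) auto
    also have "\<dots> < e"
      using C(1) e by (simp add: field_simps)
    finally show ?thesis .
  qed
  then show ?thesis by blast
qed

section \<open>The distance from the Fourier transform\<close>

lemma integrable_gaussian_complex: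
  "integrable lborel (\<lambda>t::'a::euclidean_space. complex_of_real (gaussian 1 t))"
  by (simp add: complex_of_real_integrable_eq integrable_gaussian)

lemma gaussian_square: "(cmod (complex_of_real (gaussian 1 t)))\<^sup>2 = gaussian 2 t"
  by (simp add: gaussian_def power2_eq_square exp_add[symmetric])

lemma square_integrable_gaussian:
  "square_integrable (\<lambda>t::'a::euclidean_space. complex_of_real (gaussian 1 t))"
  unfolding square_integrable_def gaussian_square by (simp add: integrable_gaussian)

lemma gaussian_L2_nonzero:
  "norm (abs_L2 (\<lambda>t::'a::euclidean_space. complex_of_real (gaussian 1 t))) > 0"
proof -
  have "ennreal ((norm (abs_L2 (\<lambda>t::'a. complex_of_real (gaussian 1 t))))\<^sup>2) > 0"
    by (simp add: nn_integral_square_eq_norm[OF square_integrable_gaussian, symmetric]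
        gaussian_square nn_integral_gaussian del: norm_of_real)
  then show ?thesis by simp
qed

text \<open>
  The Gaussian with \<open>c = 1\<close> is a fixed point of the Fourier transform, which turns the
  translation by \<open>y\<close> into a modulation by \<open>- y\<close>.
\<close>

lemma fourier_translated_gaussian:
  fixes y :: "'a::euclidean_space"
  defines "\<gamma> \<equiv> abs_L2 (\<lambda>t::'a. complex_of_real (gaussian 1 t))"
  shows "blinfun_apply fourier (tf_shift (y, 0) \<gamma>) = tf_shift (0, - y) \<gamma>"
proof -
  let ?g = "\<lambda>t::'a. complex_of_real (gaussian 1 t)"
  have "integrable lborel (\<lambda>t. ?g (t - y))"
  proof -
    have "integrable (distr lborel borel ((+) (- y))) ?g"
      unfolding lborel_distr_plus by (rule integrable_gaussian_complex)
    then show ?thesis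
      by (subst (asm) integrable_distr_eq) auto
  qed
  moreover have "square_integrable (\<lambda>t. ?g (t - y))"
    by (rule square_integrable_translate[OF square_integrable_gaussian])
  ultimately have "blinfun_apply fourier (abs_L2 (\<lambda>t. ?g (t - y))) = abs_L2 (fourier_integral (\<lambda>t. ?g (t - y)))"
    by (rule fourier_properties(2))
  also have "fourier_integral (\<lambda>t. ?g (t - y)) = (\<lambda>\<omega>. cis (2 * pi * (- y \<bullet> \<omega>)) * ?g \<omega>)"
  proof
    fix \<omega>
    have "fourier_integral (\<lambda>t. ?g (t - y)) \<omega> = cis (- (2 * pi * (\<omega> \<bullet> y))) * fourier_integral ?g \<omega>"
      by (rule fourier_integral_translate) measurable
    then show "fourier_integral (\<lambda>t. ?g (t - y)) \<omega> = cis (2 * pi * (- y \<bullet> \<omega>)) * ?g \<omega>"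
      by (simp add: fourier_integral_gaussian inner_commute)
  qed
  finally show ?thesis
    by (simp add: \<gamma>_def tf_shift_abs_L2 square_integrable_gaussian)
qed

text \<open>
  Test the difference on the Gaussian translated by \<open>y\<close> against the image of that function under
  the Fourier transform.  These two wave packets sit at \<open>(y, 0)\<close> and \<open>(0, - y)\<close>, at a distance of at
  least \<open>\<bar>y\<bar>\<close> from each other.
\<close>

lemma norm_fourier_minus_localization_op:
  fixes \<phi>1 \<phi>2 :: "'a::euclidean_space L2"
  assumes a: "a \<in> Linfty"
  shows "norm (fourier - localization_op \<phi>1 \<phi>2 a) \<ge> 1"
proof -
  let ?A = "localization_op \<phi>1 \<phi>2 a"
  define \<gamma> where "\<gamma> = abs_L2 (\<lambda>t::'a. complex_of_real (gaussian 1 t))"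
  have \<gamma>: "norm \<gamma> > 0"
    unfolding \<gamma>_def by (rule gaussian_L2_nonzero)
  have key: "(norm \<gamma>)\<^sup>2 \<le> norm (fourier - ?A) * (norm \<gamma>)\<^sup>2 + e" if e: "e > 0" for e
  proof -
    obtain R where R: "\<forall>w w'. norm (w - w') > R \<longrightarrow>
        cmod (cinner (blinfun_apply ?A (tf_shift w \<gamma>)) (tf_shift w' \<gamma>)) < e"
      using localization_op_off_diagonal_bound[OF a e] by (rule exE)
    define y :: 'a where "y = (\<bar>R\<bar> + 1) *\<^sub>R (SOME b. b \<in> Basis)"
    define f where "f = tf_shift (y, 0) \<gamma>"
    define g where "g = tf_shift (0, - y) \<gamma>"
    have fg: "norm f = norm \<gamma>" "norm g = norm \<gamma>" "blinfun_apply fourier f = g"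
      by (simp_all add: f_def g_def norm_tf_shift \<gamma>_def fourier_translated_gaussian)
    have "R < norm y"
      by (simp add: y_def norm_Basis[OF SOME_Basis])
    also have "norm y \<le> norm ((y, 0) - (0, - y))"
      using norm_fst_le[of y y] by simp
    finally have small: "cmod (cinner (blinfun_apply ?A f) g) < e"
      unfolding f_def g_def by (rule R[rule_format])
    have "(norm \<gamma>)\<^sup>2 = cmod (cinner g g)"
      by (simp add: cinner_self norm_power fg)
    also have "cinner g g = cinner (blinfun_apply (fourier - ?A) f) g + cinner (blinfun_apply ?A f) g"
      by (simp add: minus_blinfun.rep_eq cinner_minus_left fg)
    also have "cmod \<dots> \<le> cmod (cinner (blinfun_apply (fourier - ?A) f) g) + e"
      using small by (intro norm_triangle_le add_left_mono) simp
    also have "cmod (cinner (blinfun_apply (fourier - ?A) f) g) \<le> norm (blinfun_apply (fourier - ?A) f) * norm g"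
      by (rule cmod_cinner_le)
    also have "\<dots> \<le> (norm (fourier - ?A) * norm f) * norm g"
      by (intro mult_right_mono norm_blinfun) simp
    finally show ?thesis
      by (simp add: fg power2_eq_square mult.assoc)
  qed
  have "(norm \<gamma>)\<^sup>2 \<le> norm (fourier - ?A) * (norm \<gamma>)\<^sup>2"
    by (rule field_le_epsilon) (rule key)
  then show ?thesis
    using \<gamma> by simp
qed

theorem theorem5p6:
  shows "(\<forall>(\<phi>1 :: (real ^ 'd) L2) (\<phi>2 :: (real ^ 'd) L2) a.
            \<phi>1 \<noteq> 0 \<longrightarrow> \<phi>2 \<noteq> 0 \<longrightarrow> a \<in> Linfty \<longrightarrow>
            norm (fourier - localization_op \<phi>1 \<phi>2 a) \<ge> 1)
       \<and> \<not> (bounded_clinear_ops :: ((real ^ 'd) L2 \<Rightarrow>\<^sub>L (real ^ 'd) L2) set)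
           \<subseteq> closure {localization_op \<phi>1 \<phi>2 a | \<phi>1 \<phi>2 a. a \<in> Linfty}"
proof (intro conjI allI impI)
  show "norm (fourier - localization_op \<phi>1 \<phi>2 a) \<ge> 1" if "a \<in> Linfty" for \<phi>1 \<phi>2 :: "(real ^ 'd) L2" and a
    using that by (rule norm_fourier_minus_localization_op)
  show "\<not> (bounded_clinear_ops :: ((real ^ 'd) L2 \<Rightarrow>\<^sub>L (real ^ 'd) L2) set)
           \<subseteq> closure {localization_op \<phi>1 \<phi>2 a | \<phi>1 \<phi>2 a. a \<in> Linfty}"
  proof
    assume "(bounded_clinear_ops :: ((real ^ 'd) L2 \<Rightarrow>\<^sub>L (real ^ 'd) L2) set)
           \<subseteq> closure {localization_op \<phi>1 \<phi>2 a | \<phi>1 \<phi>2 a. a \<in> Linfty}"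
    then have "(fourier :: (real ^ 'd) L2 \<Rightarrow>\<^sub>L (real ^ 'd) L2)
        \<in> closure {localization_op \<phi>1 \<phi>2 a | \<phi>1 \<phi>2 a. a \<in> Linfty}"
      using fourier_properties(1) by blast
    then obtain \<phi>1 \<phi>2 :: "(real ^ 'd) L2" and a where
      "a \<in> Linfty" "dist (localization_op \<phi>1 \<phi>2 a) fourier < 1"
      by (auto simp: closure_approachable dest!: spec[of _ "1 :: real"])
    then show False
      using norm_fourier_minus_localization_op[of a \<phi>1 \<phi>2] by (simp add: dist_norm norm_minus_commute)
  qed
qed

end
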